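(* For every positive integer $v\equiv 0\pmod 4$ with $v\notin\{40,44,52,76,92,100,280,284,328,332,428,472,476,572\}$, there exists a $(K_2,K_{1,3})$-URD$\left(v;\,r(v),\,\frac{2(v-1-r(v))}{3}\right)$, where $r(v)=5$ if $v\equiv 0\pmod{12}$, $r(v)=3$ if $v\equiv 4\pmod{12}$, and $r(v)=1$ if $v\equiv 8\pmod{12}$.
   Context: $K_v$ is the complete graph on $v$ vertices. A 3-star is a copy of $K_{1,3}$. For a graph $G$, a class (parallel class) is a set of subgraphs (blocks) of $G$ such that every vertex of $G$ lies in exactly one block of the set. For non-negative integers $r,s$, a $(K_2,K_{1,3})$-URD$(v;r,s)$ is a uniformly resolvable decomposition of $K_v$: a decomposition (partition) of the edge set of $K_v$ into copies of $K_2$ and copies of $K_{1,3}$, together with a partition of all these blocks into $r+s$ classes, where $r$ classes consist only of copies of $K_2$ (i.e. are 1-factors of $K_v$) and $s$ classes consist only of 3-stars. *)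

theory Defs
  imports Complex_Main "HOL-Library.Disjoint_Sets" "HOL-Library.Ramsey"
begin

text \<open>
  Blocks have no isolated vertices, so a block is given by its set of edges (two-element vertex
  sets) and its vertex set is the union of these edges. The edge set of the complete graph on
  the vertex set \<open>V\<close> is \<open>nsets V 2\<close>.
\<close>

type_synonym 'a block = "'a set set"

definition copy_of :: "'b block \<Rightarrow> 'a block \<Rightarrow> bool" where
  "copy_of H B \<longleftrightarrow> (\<exists>f. inj_on f (\<Union>H) \<and> B = (\<lambda>e. f ` e) ` H)"

definition K2 :: "nat block" where
  "K2 = {{0, 1}}"

definition K13 :: "nat block" where
  "K13 = {{0, 1}, {0, 2}, {0, 3}}"

definition parallel_class :: "'a set \<Rightarrow> 'a block set \<Rightarrow> bool" where
  "parallel_class V C \<longleftrightarrow> (\<forall>x\<in>V. \<exists>!B. B \<in> C \<and> x \<in> \<Union>B)"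

text \<open>
  \<open>\<B>\<close> is the set of blocks of the decomposition, \<open>\<F>\<close> the set of classes consisting of copies of
  \<open>K2\<close>, and \<open>\<S>\<close> the set of classes consisting of 3-stars.
\<close>

definition K2_K13_URD_on ::
  "'a set \<Rightarrow> nat \<Rightarrow> nat \<Rightarrow> 'a block set \<Rightarrow> 'a block set set \<Rightarrow> 'a block set set \<Rightarrow> bool" where
  "K2_K13_URD_on V r s \<B> \<F> \<S> \<longleftrightarrow>
     finite V \<and>
     partition_on (nsets V 2) \<B> \<and>
     (\<forall>B\<in>\<B>. copy_of K2 B \<or> copy_of K13 B) \<and>
     partition_on \<B> (\<F> \<union> \<S>) \<and> \<F> \<inter> \<S> = {} \<and>
     card \<F> = r \<and> card \<S> = s \<and>
     (\<forall>C\<in>\<F>. parallel_class V C \<and> (\<forall>B\<in>C. copy_of K2 B)) \<and>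
     (\<forall>C\<in>\<S>. parallel_class V C \<and> (\<forall>B\<in>C. copy_of K13 B))"

definition exists_K2_K13_URD :: "nat \<Rightarrow> nat \<Rightarrow> nat \<Rightarrow> bool" where
  "exists_K2_K13_URD v r s \<longleftrightarrow> (\<exists>\<B> \<F> \<S>. K2_K13_URD_on {..<v} r s \<B> \<F> \<S>)"

text \<open>Only the values at multiples of 4 matter, so the last case is \<open>v mod 12 = 8\<close>.\<close>

definition r_of :: "nat \<Rightarrow> nat" where
  "r_of v = (if v mod 12 = 0 then 5 else if v mod 12 = 4 then 3 else 1)"

definition s_of :: "nat \<Rightarrow> nat" where
  "s_of v = 2 * (v - 1 - r_of v) div 3"

text \<open>For the relevant \<open>v\<close>, neither the subtraction nor the division above truncates.\<close>

lemma s_of_exact: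
  assumes "v > 0" and "v mod 4 = 0"
  shows "real (s_of v) = 2 * (real v - 1 - real (r_of v)) / 3"
proof -
  have "3 * s_of v + 2 * (1 + r_of v) = 2 * v"
  proof -
    have "v mod 12 = 0 \<or> v mod 12 = 4 \<or> v mod 12 = 8"
      using assms(2) by presburger
    then show ?thesis
    proof (elim disjE)
      assume h: "v mod 12 = 0"
      then obtain k where "v = 12 * k" by auto
      with assms(1) obtain j where "v = 12 * Suc j"
        by (cases k) auto
      then show ?thesis by (simp add: s_of_def r_of_def)
    next
      assume h: "v mod 12 = 4"
      then have "v = 12 * (v div 12) + 4" by presburger
      then obtain k where "v = 12 * k + 4" by blast
      then show ?thesis by (simp add: s_of_def r_of_def)
    next
      assume h: "v mod 12 = 8"
      then have "v = 12 * (v div 12) + 8" by presburger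
      then obtain k where "v = 12 * k + 8" by blast
      then show ?thesis by (simp add: s_of_def r_of_def)
    qed
  qed
  then have "real (3 * s_of v + 2 * (1 + r_of v)) = real (2 * v)" by (rule arg_cong)
  then show ?thesis by simp
qed

end

theory Submission
  imports Defs "HOL-Library.Multiset"
begin

text \<open>
  Write \<open>v = 12 N + w\<close> with \<open>w\<close> one of 4, 8, 12, and arrange the vertices in \<open>N\<close> layers of 12 points
  together with \<open>w\<close> points at infinity. For \<open>N \<ge> 3\<close> the arcs of the complete digraph on the layers are
  partitioned into \<open>N\<close> permutations, the \<open>z\<close>-th one acting without fixed points on the layers other than
  \<open>z\<close>. Each permutation carries 8 partial star classes: every layer contains three centres, whose nine
  leaves lie in the next layer, so that an arc uses up half of the 144 edges between its two layers,
  and the opposite arc the other half. A partial class missing layer \<open>z\<close> is completed by a star class of a design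
  on layer \<open>z\<close> and the points at infinity. The local pieces (the stars along an arc, the designs on
  \<open>12 + w\<close> points with a subdesign on the points at infinity, and the cases \<open>N = 2\<close>) are finite tables
  found by a SAT solver.
\<close>

section \<open>Resolvable decompositions given by maps\<close>

text \<open>A further layer raises \<open>v\<close> by 12 and thus, at constant \<open>r\<close>,
  the number of star classes by 2 * 12 / 3 = 8: these are the classes attached to that layer, and
  \<open>r\<close> depends on \<open>w\<close> alone. All local designs share the points at
  infinity, so an edge between two of these points would be repeated \<open>N\<close> times. Hence
  the eight classes of a design that complete partial classes must avoid such edges, while its other
  classes split into a part on the layer and a part at infinity and can be used on all layers at
  once. Finite tables suffice because only a few kinds of arc occur. For odd \<open>N\<close> the
  permutations are the reflections y -> 2 z - y modulo \<open>N\<close>; all cycles have length 2,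
  and two kinds are enough. For even \<open>N\<close> such a reflection would also fix z + N/2.
  Instead a layer is added to the odd case; the rerouted reflections then contain a 3-cycle each,
  and a rotation of odd length takes up the arcs set free, which accounts for the remaining kinds.
  For \<open>N = 2\<close> nothing of this sort exists: the only layer besides \<open>z\<close>
  would have to be moved to a different one.\<close>

definition matching_map :: "'a set \<Rightarrow> ('a \<Rightarrow> 'a) \<Rightarrow> bool" where
  "matching_map V f \<longleftrightarrow> (\<forall>x\<in>V. f x \<in> V \<and> f x \<noteq> x \<and> f (f x) = x)"

text \<open>A star factor is coded by the retraction of the points onto the centres of their
  stars.\<close>

definition star_map :: "'a set \<Rightarrow> ('a \<Rightarrow> 'a) \<Rightarrow> bool" where
  "star_map V f \<longleftrightarrow>
     (\<forall>x\<in>V. f x \<in> V \<and> f (f x) = f x) \<and>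
     (\<forall>c\<in>V. f c = c \<longrightarrow> card {x \<in> V. x \<noteq> c \<and> f x = c} = 3)"

text \<open>An edge belongs to class \<open>i\<close> iff \<open>f i\<close> sends one end to the
  other, so the uniqueness condition on pairs of points encodes both partitions, that of the edges
  into blocks and that of the blocks into classes.\<close>

definition urd_maps :: "'a set \<Rightarrow> 'i set \<Rightarrow> 'i set \<Rightarrow> ('i \<Rightarrow> 'a \<Rightarrow> 'a) \<Rightarrow> bool" where
  "urd_maps V I J f \<longleftrightarrow>
     finite V \<and> finite I \<and> finite J \<and> I \<inter> J = {} \<and>
     (\<forall>i\<in>I. matching_map V (f i)) \<and> (\<forall>j\<in>J. star_map V (f j)) \<and>
     (\<forall>x\<in>V. \<forall>y\<in>V. x \<noteq> y \<longrightarrow> (\<exists>!i. i \<in> I \<union> J \<and> (f i x = y \<or> f i y = x)))"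

lemma matching_mapD:
  assumes "matching_map V f" "x \<in> V"
  shows "f x \<in> V" "f x \<noteq> x" "f (f x) = x"
  using assms by (auto simp: matching_map_def)

lemma star_mapD:
  assumes "star_map V f" "x \<in> V"
  shows "f x \<in> V" "f (f x) = f x"
  using assms by (auto simp: star_map_def)

lemma star_map_leaves:
  assumes "star_map V f" "c \<in> V" "f c = c"
  shows "card {x \<in> V. x \<noteq> c \<and> f x = c} = 3"
  using assms by (auto simp: star_map_def)

section \<open>Transport along a bijection\<close>

lemma matching_map_bij:
  assumes g: "bij_betw g V W" and f: "matching_map V f"
  shows "matching_map W (\<lambda>y. g (f (the_inv_into V g y)))"
  unfolding matching_map_def
proof (intro ballI)
  fix y assume "y \<in> W"
  then obtain x where x: "x \<in> V" "y = g x" using g by (auto simp: bij_betw_def)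
  have inj: "inj_on g V" using g by (auto simp: bij_betw_def)
  have "g ` V = W" using g by (auto simp: bij_betw_def)
  with x matching_mapD[OF f x(1)] inj show
    "g (f (the_inv_into V g y)) \<in> W \<and> g (f (the_inv_into V g y)) \<noteq> y \<and>
     g (f (the_inv_into V g (g (f (the_inv_into V g y))))) = y"
    by (auto simp: the_inv_into_f_f inj_on_eq_iff)
qed

lemma star_map_bij:
  assumes g: "bij_betw g V W" and f: "star_map V f"
  shows "star_map W (\<lambda>y. g (f (the_inv_into V g y)))"
  unfolding star_map_def
proof (intro conjI ballI impI)
  have inj: "inj_on g V" and im: "g ` V = W" using g by (auto simp: bij_betw_def)
  {
    fix y assume "y \<in> W"
    then obtain x where x: "x \<in> V" "y = g x" using im by auto
    show "g (f (the_inv_into V g y)) \<in> W"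
      using x star_mapD[OF f x(1)] inj im by (auto simp: the_inv_into_f_f)
    show "g (f (the_inv_into V g (g (f (the_inv_into V g y))))) = g (f (the_inv_into V g y))"
      using x star_mapD[OF f x(1)] inj im by (auto simp: the_inv_into_f_f)
  next
    fix y assume "y \<in> W" and y: "g (f (the_inv_into V g y)) = y"
    then obtain x where x: "x \<in> V" "y = g x" using im by auto
    have fx: "f x = x"
      using y x star_mapD[OF f x(1)] inj by (auto simp: the_inv_into_f_f inj_on_eq_iff)
    have "{z \<in> W. z \<noteq> y \<and> g (f (the_inv_into V g z)) = y} = g ` {z \<in> V. z \<noteq> x \<and> f z = x}"
      using x inj im star_mapD[OF f] by (auto simp: the_inv_into_f_f inj_on_eq_iff)
    moreover have "card (g ` {z \<in> V. z \<noteq> x \<and> f z = x}) = card {z \<in> V. z \<noteq> x \<and> f z = x}"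
      using inj by (intro card_image) (auto simp: inj_on_def)
    ultimately show "card {z \<in> W. z \<noteq> y \<and> g (f (the_inv_into V g z)) = y} = 3"
      using star_map_leaves[OF f x(1) fx] by simp
  }
qed

lemma urd_maps_map_in:
  assumes "urd_maps V I J f" "i \<in> I \<union> J" "x \<in> V"
  shows "f i x \<in> V"
  using assms by (auto simp: urd_maps_def matching_map_def star_map_def)

lemma urd_maps_bij:
  assumes g: "bij_betw g V W" and u: "urd_maps V I J f"
  shows "urd_maps W I J (\<lambda>i y. g (f i (the_inv_into V g y)))"
  unfolding urd_maps_def
proof (intro conjI ballI impI)
  have inj: "inj_on g V" and im: "g ` V = W" using g by (auto simp: bij_betw_def)
  show "finite W" using u im by (auto simp: urd_maps_def)
  show "finite I" "finite J" "I \<inter> J = {}" using u by (auto simp: urd_maps_def)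
  show "matching_map W (\<lambda>y. g (f i (the_inv_into V g y)))" if "i \<in> I" for i
    using u that by (intro matching_map_bij[OF g]) (auto simp: urd_maps_def)
  show "star_map W (\<lambda>y. g (f i (the_inv_into V g y)))" if "i \<in> J" for i
    using u that by (intro star_map_bij[OF g]) (auto simp: urd_maps_def)
  fix x' y' assume "x' \<in> W" "y' \<in> W" "x' \<noteq> y'"
  then obtain x y where xy: "x \<in> V" "y \<in> V" "x' = g x" "y' = g y" "x \<noteq> y" using im by auto
  have "\<exists>!i. i \<in> I \<union> J \<and> (f i x = y \<or> f i y = x)"
    using u xy by (auto simp: urd_maps_def)
  moreover have "(g (f i (the_inv_into V g x')) = y' \<or> g (f i (the_inv_into V g y')) = x')
      \<longleftrightarrow> (f i x = y \<or> f i y = x)" if "i \<in> I \<union> J" for i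
    using xy inj urd_maps_map_in[OF u that] by (auto simp: the_inv_into_f_f inj_on_eq_iff)
  ultimately show "\<exists>!i. i \<in> I \<union> J \<and> (g (f i (the_inv_into V g x')) = y' \<or>
      g (f i (the_inv_into V g y')) = x')" by (metis (no_types, lifting))
qed

text \<open>For a matching as well as for a star factor, this is the block through \<open>x\<close>.\<close>

definition map_block :: "'a set \<Rightarrow> ('a \<Rightarrow> 'a) \<Rightarrow> 'a \<Rightarrow> 'a block" where
  "map_block V f x = {{y, f y} |y. y \<in> V \<and> f y \<noteq> y \<and> (f y = f x \<or> f y = x)}"

section \<open>From maps to blocks and classes\<close>

lemma map_block_matching:
  assumes "matching_map V f" "x \<in> V"
  shows "map_block V f x = {{x, f x}}"
proof -
  have "{y \<in> V. f y \<noteq> y \<and> (f y = f x \<or> f y = x)} = {x, f x}"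
    using assms by (auto simp: matching_map_def) metis
  moreover have "map_block V f x = (\<lambda>y. {y, f y}) ` {y \<in> V. f y \<noteq> y \<and> (f y = f x \<or> f y = x)}"
    by (auto simp: map_block_def)
  ultimately show ?thesis using matching_mapD[OF assms] by (auto simp: doubleton_eq_iff)
qed

lemma map_block_star:
  assumes "star_map V f" "x \<in> V"
  shows "map_block V f x = (\<lambda>y. {f x, y}) ` {y \<in> V. y \<noteq> f x \<and> f y = f x}"
proof -
  have "{y \<in> V. f y \<noteq> y \<and> (f y = f x \<or> f y = x)} = {y \<in> V. y \<noteq> f x \<and> f y = f x}"
    using assms by (auto simp: star_map_def)
  moreover have "map_block V f x = (\<lambda>y. {f y, y}) ` {y \<in> V. f y \<noteq> y \<and> (f y = f x \<or> f y = x)}"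
    by (auto simp: map_block_def insert_commute)
  ultimately show ?thesis by auto
qed

lemma map_block_subset_nsets:
  assumes "matching_map V f \<or> star_map V f"
  shows "map_block V f x \<subseteq> nsets V 2"
  using assms by (auto simp: map_block_def nsets_def matching_map_def star_map_def card_insert_if)

lemma mem_map_block:
  assumes "matching_map V f \<or> star_map V f" "x \<in> V"
  shows "x \<in> \<Union>(map_block V f x)"
  using assms(1)
proof
  assume "matching_map V f" then show ?thesis using map_block_matching assms(2) by fastforce
next
  assume s: "star_map V f"
  have "f x \<in> V" "f (f x) = f x" using star_mapD[OF s assms(2)] by auto
  from star_map_leaves[OF s this] have "{y \<in> V. y \<noteq> f x \<and> f y = f x} \<noteq> {}"
    by (metis card.empty zero_neq_numeral)
  then show ?thesis unfolding map_block_star[OF s assms(2)] using assms(2) by (cases "f x = x") auto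
qed

lemma map_block_eq:
  assumes "matching_map V f \<or> star_map V f" "x \<in> V" "y \<in> \<Union>(map_block V f x)"
  shows "map_block V f y = map_block V f x"
  using assms(1)
proof
  assume m: "matching_map V f"
  then have "y = x \<or> y = f x" using assms by (auto simp: map_block_matching)
  then show ?thesis using map_block_matching[OF m] assms(2) matching_mapD[OF m assms(2)]
    by (auto simp: insert_commute)
next
  assume s: "star_map V f"
  have "y \<in> V \<and> f y = f x"
    using assms(2,3) star_mapD[OF s assms(2)] by (auto simp: map_block_star[OF s] split: if_splits)
  then show ?thesis using map_block_star[OF s] assms(2) by simp
qed

lemma parallel_class_map_block:
  assumes "matching_map V f \<or> star_map V f"
  shows "parallel_class V (map_block V f ` V)"
  unfolding parallel_class_def
proof
  fix x assume x: "x \<in> V"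
  show "\<exists>!B. B \<in> map_block V f ` V \<and> x \<in> \<Union>B"
  proof (rule ex1I[of _ "map_block V f x"])
    show "map_block V f x \<in> map_block V f ` V \<and> x \<in> \<Union>(map_block V f x)"
      using mem_map_block[OF assms x] x by auto
    show "B = map_block V f x" if "B \<in> map_block V f ` V \<and> x \<in> \<Union>B" for B
      using that map_block_eq[OF assms, of _ x] by auto
  qed
qed

lemma copy_of_K2_edge:
  assumes "x \<noteq> y"
  shows "copy_of K2 {{x, y}}"
  unfolding copy_of_def K2_def
  by (rule exI[of _ "\<lambda>n::nat. if n = 0 then x else y"]) (use assms in \<open>auto simp: inj_on_def\<close>)

lemma copy_of_K13_star:
  assumes "card L = 3" "c \<notin> L"
  shows "copy_of K13 ((\<lambda>y. {c, y}) ` L)"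
proof -
  obtain p q r where L: "L = {p, q, r}" "p \<noteq> q" "q \<noteq> r" "p \<noteq> r"
    using assms(1) by (auto simp: card_3_iff)
  show ?thesis
    unfolding copy_of_def K13_def
    by (rule exI[of _ "\<lambda>n::nat. if n = 0 then c else if n = 1 then p else if n = 2 then q else r"])
      (use L assms(2) in \<open>auto simp: inj_on_def\<close>)
qed

lemma copy_of_map_block:
  assumes "x \<in> V"
  shows "matching_map V f \<Longrightarrow> copy_of K2 (map_block V f x)"
    and "star_map V f \<Longrightarrow> copy_of K13 (map_block V f x)"
proof -
  show "copy_of K2 (map_block V f x)" if m: "matching_map V f"
    using copy_of_K2_edge[of x "f x"] matching_mapD[OF m assms] map_block_matching[OF m assms] by auto
  show "copy_of K13 (map_block V f x)" if s: "star_map V f"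
    unfolding map_block_star[OF s assms]
    by (rule copy_of_K13_star) (use star_map_leaves[OF s] star_mapD[OF s assms] in auto)
qed

text \<open>Classes are indexed in \<open>urd_maps\<close> but form sets in the target, so different
  indices must be shown to give different classes. Over an empty \<open>V\<close> every
  \<open>C i\<close> would be the same empty set, hence the second hypothesis.\<close>

lemma urd_maps_imp_URD_on:
  assumes u: "urd_maps V I J f" and ne: "V \<noteq> {}"
  shows "\<exists>\<B> \<F> \<S>. K2_K13_URD_on V (card I) (card J) \<B> \<F> \<S>"
proof -
  define C where "C i = map_block V (f i) ` V" for i
  define B where "B = (\<Union>i\<in>I \<union> J. C i)"
  have fin: "finite V" "I \<inter> J = {}"
    and fI: "\<And>i. i \<in> I \<Longrightarrow> matching_map V (f i)" and fJ: "\<And>i. i \<in> J \<Longrightarrow> star_map V (f i)"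
    using u by (auto simp: urd_maps_def)
  have f: "matching_map V (f i) \<or> star_map V (f i)" if "i \<in> I \<union> J" for i
    using that fI fJ by auto
  have uniq: "\<exists>!i. i \<in> I \<union> J \<and> (f i x = y \<or> f i y = x)" if "x \<in> V" "y \<in> V" "x \<noteq> y" for x y
    using u that by (auto simp: urd_maps_def)
  \<comment> \<open>An edge determines its class by the uniqueness of the index, and then its block
    as the one through an endpoint. Disjointness of blocks, disjointness of classes and injectivity
    of \<open>C\<close> all come from this.\<close>
  have same: "i = j \<and> b = c"
    if ij: "i \<in> I \<union> J" "j \<in> I \<union> J" "b \<in> C i" "c \<in> C j" and e: "e \<in> b" "e \<in> c" for i j b c e
  proof -
    obtain x x' where x: "x \<in> V" "b = map_block V (f i) x" "x' \<in> V" "c = map_block V (f j) x'"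
      using ij by (auto simp: C_def)
    have "e \<in> map_block V (f i) x" "e \<in> map_block V (f j) x'" using e x by simp_all
    then obtain y z where y: "y \<in> V" "f i y \<noteq> y" "e = {y, f i y}"
      and z: "z \<in> V" "f j z \<noteq> z" "e = {z, f j z}"
      unfolding map_block_def by blast
    have "\<exists>!l. l \<in> I \<union> J \<and> (f l y = f i y \<or> f l (f i y) = y)"
      using uniq[OF y(1) urd_maps_map_in[OF u ij(1) y(1)] y(2)[symmetric]] .
    then obtain l where l: "\<And>m. m \<in> I \<union> J \<Longrightarrow> f m y = f i y \<or> f m (f i y) = y \<Longrightarrow> m = l"
      by (elim ex1E) blast
    have "f j y = f i y \<or> f j (f i y) = y" using y z by (auto simp: doubleton_eq_iff)
    then have "j = l" by (rule l[OF ij(2)])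
    moreover have "i = l" by (rule l[OF ij(1)]) simp
    ultimately have ij': "i = j" by simp
    have yb: "y \<in> \<Union>b" "y \<in> \<Union>c" using e y(3) by blast+
    have "map_block V (f i) y = b"
      using map_block_eq[OF f[OF ij(1)] x(1), of y] yb(1) unfolding x(2) by simp
    moreover have "map_block V (f j) y = c"
      using map_block_eq[OF f[OF ij(2)] x(3), of y] yb(2) unfolding x(4) by simp
    ultimately show ?thesis using ij' by simp
  qed
  have Cne: "C i \<noteq> {}" for i using ne by (auto simp: C_def)
  have bne: "b \<noteq> {}" if "i \<in> I \<union> J" "b \<in> C i" for i b
    using that mem_map_block[OF f[OF that(1)]] by (fastforce simp: C_def)
  have sub: "b \<subseteq> nsets V 2" if "i \<in> I \<union> J" "b \<in> C i" for i b
    using that map_block_subset_nsets[OF f[OF that(1)]] by (auto simp: C_def)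
  have same': "i = j" if "i \<in> I \<union> J" "j \<in> I \<union> J" "b \<in> C i" "b \<in> C j" for i j b
    using bne[OF that(1,3)] same[OF that] by auto
  have inj: "inj_on C (I \<union> J)"
    using Cne same' by (intro inj_onI) (metis ex_in_conv)
  have cover: "nsets V 2 \<subseteq> \<Union>B"
  proof
    fix e assume "e \<in> nsets V 2"
    then obtain x y where e: "e = {x, y}" "x \<noteq> y" "x \<in> V" "y \<in> V"
      by (auto simp: nsets_def card_2_iff)
    then obtain i where i: "i \<in> I \<union> J" "f i x = y \<or> f i y = x" using uniq by blast
    then have "e \<in> map_block V (f i) x \<or> e \<in> map_block V (f i) y"
      using e by (auto simp: map_block_def insert_commute)
    then show "e \<in> \<Union>B" using i e by (auto simp: B_def C_def)
  qed
  have "K2_K13_URD_on V (card I) (card J) B (C ` I) (C ` J)"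
    unfolding K2_K13_URD_on_def
  proof (intro conjI ballI)
    show "finite V" by fact
    show "partition_on (nsets V 2) B"
    proof (rule partition_onI)
      show "\<Union>B = nsets V 2" using cover sub by (auto simp: B_def)
      show "disjnt b c" if bc: "b \<in> B" "c \<in> B" "b \<noteq> c" for b c
      proof -
        obtain i where i: "i \<in> I \<union> J" "b \<in> C i" using bc(1) unfolding B_def by blast
        obtain j where j: "j \<in> I \<union> J" "c \<in> C j" using bc(2) unfolding B_def by blast
        show ?thesis unfolding disjnt_iff using same[OF i(1) j(1) i(2) j(2)] bc(3) by blast
      qed
      show "{} \<notin> B" using bne by (auto simp: B_def)
    qed
    show "partition_on B (C ` I \<union> C ` J)"
    proof (rule partition_onI)
      show "\<Union>(C ` I \<union> C ` J) = B" by (auto simp: B_def)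
      show "disjnt p q" if pq: "p \<in> C ` I \<union> C ` J" "q \<in> C ` I \<union> C ` J" "p \<noteq> q" for p q
      proof -
        obtain i j where "i \<in> I \<union> J" "j \<in> I \<union> J" "p = C i" "q = C j"
          using pq(1,2) unfolding image_Un[symmetric] by blast
        then show ?thesis using same'[of i j] pq(3) unfolding disjnt_iff by blast
      qed
      show "{} \<notin> C ` I \<union> C ` J" using Cne by (metis (no_types) image_Un image_iff)
    qed
    show "C ` I \<inter> C ` J = {}"
      using fin(2) inj_on_image_Int[OF inj, of I J] by simp
    show "card (C ` I) = card I" "card (C ` J) = card J"
      using inj by (auto intro!: card_image simp: inj_on_Un)
    show "parallel_class V p" if "p \<in> C ` I" for p
      using that parallel_class_map_block f by (auto simp: C_def)
    show "parallel_class V p" if "p \<in> C ` J" for p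
      using that parallel_class_map_block f by (auto simp: C_def)
    show "copy_of K2 b" if "p \<in> C ` I" "b \<in> p" for p b
      using that fI by (auto simp: C_def intro: copy_of_map_block)
    show "copy_of K13 b" if "p \<in> C ` J" "b \<in> p" for p b
      using that fJ by (auto simp: C_def intro: copy_of_map_block)
    show "copy_of K2 b \<or> copy_of K13 b" if "b \<in> B" for b
      using that fI fJ by (auto simp: B_def C_def intro: copy_of_map_block)
  qed
  then show ?thesis by blast
qed

lemma urd_maps_imp_exists:
  assumes "urd_maps V I J f" and "V \<noteq> {}"
  shows "exists_K2_K13_URD (card V) (card I) (card J)"
proof -
  have "finite V" using assms by (auto simp: urd_maps_def)
  then obtain g where "bij_betw g V {0..<card V}" using ex_bij_betw_finite_nat by blast
  then have g: "bij_betw g V {..<card V}" by (simp add: lessThan_atLeast0)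
  have "0 < card V" using assms(2) \<open>finite V\<close> by (simp add: card_gt_0_iff)
  then have "{..<card V} \<noteq> {}" by (metis empty_iff lessThan_iff)
  from urd_maps_imp_URD_on[OF urd_maps_bij[OF g assms(1)] this] show ?thesis
    unfolding exists_K2_K13_URD_def .
qed

section \<open>Filling the holes of a frame\<close>

text \<open>The maps with indices \<open>r, \<dots>, r + 7\<close> are the star classes of a \<open>(12 + w)\<close>-point design that
  leave the hole \<open>{12..<12 + w}\<close> free of edges; all the others split along the hole.\<close>

locale subsystem =
  fixes w r s :: nat and f :: "nat \<Rightarrow> nat \<Rightarrow> nat"
  assumes f_urd: "urd_maps {..<12 + w} {..<r} {r..<r + 8 + s} f"
    and f_preserves: "\<lbrakk>i < r \<or> r + 8 \<le> i \<and> i < r + 8 + s; a < 12 + w\<rbrakk> \<Longrightarrow> f i a < 12 \<longleftrightarrow> a < 12"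
    and f_hole: "\<lbrakk>r \<le> i; i < r + 8; 12 \<le> a; a < 12 + w\<rbrakk> \<Longrightarrow> f i a = a \<or> f i a < 12"

text \<open>The partial classes missing layer \<open>z\<close> are built from the permutation of the other layers with
  predecessor map \<open>P z\<close>: in partial class \<open>k\<close> the point \<open>a\<close> of layer \<open>y\<close> is a centre if \<open>G z y k a = 12\<close>,
  and otherwise a leaf of the point \<open>G z y k a\<close> of layer \<open>P z y\<close>.\<close>

locale frame_filling = subsystem w r s f for w r s :: nat and f :: "nat \<Rightarrow> nat \<Rightarrow> nat" +
  fixes N :: nat
    and P :: "nat \<Rightarrow> nat \<Rightarrow> nat"
    and G :: "nat \<Rightarrow> nat \<Rightarrow> nat \<Rightarrow> nat \<Rightarrow> nat"
  assumes P_less: "\<lbrakk>z < N; y < N; y \<noteq> z\<rbrakk> \<Longrightarrow> P z y < N"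
    and P_neq: "\<lbrakk>z < N; y < N; y \<noteq> z\<rbrakk> \<Longrightarrow> P z y \<noteq> z \<and> P z y \<noteq> y"
    and P_inj_layer: "\<lbrakk>z < N; y < N; y \<noteq> z; y' < N; y' \<noteq> z; P z y = P z y'\<rbrakk> \<Longrightarrow> y = y'"
    and P_inj_class: "\<lbrakk>y < N; z < N; y \<noteq> z; z' < N; y \<noteq> z'; P z y = P z' y\<rbrakk> \<Longrightarrow> z = z'"
    and G_le: "\<lbrakk>z < N; y < N; y \<noteq> z; k < 8; a < 12\<rbrakk> \<Longrightarrow> G z y k a \<le> 12"
    and G_children: "\<lbrakk>z < N; y < N; y \<noteq> z; k < 8; a < 12\<rbrakk> \<Longrightarrow>
      card {b. b < 12 \<and> G z y k b = a} = (if G z (P z y) k a = 12 then 3 else 0)"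
    and G_cover: "\<lbrakk>x < N; y < N; z < N; z' < N; y \<noteq> z; x \<noteq> z'; P z y = x; P z' x = y; a < 12; b < 12\<rbrakk> \<Longrightarrow>
      card {k. k < 8 \<and> G z y k b = a} + card {k. k < 8 \<and> G z' x k a = b} = 1"
begin

definition V :: "(nat \<times> nat) set" where
  "V = {..<N} \<times> {..<12} \<union> {N} \<times> {12..<12 + w}"

text \<open>This places the local design on layer \<open>z\<close> and the points at infinity. Those
  points keep the numbers from 12 on, so second coordinates are already the numbering of the
  design.\<close>

definition embed :: "nat \<Rightarrow> nat \<Rightarrow> nat \<times> nat" where
  "embed z a = (if a < 12 then z else N, a)"

text \<open>Classes \<open>(N, i)\<close> use the subsystem on every layer and on the points at infinity; a class
  \<open>(z, r + k)\<close> with \<open>z < N\<close> is the partial class number \<open>k\<close> missing layer \<open>z\<close>, completed by a star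
  factor on layer \<open>z\<close> and the points at infinity.\<close>

definition F :: "nat \<times> nat \<Rightarrow> nat \<times> nat \<Rightarrow> nat \<times> nat" where
  "F = (\<lambda>(z, i) (x, a).
     if z = N then (x, f i a)
     else if x = z \<or> x = N then embed z (f i a)
     else if G z x (i - r) a = 12 then (x, a)
     else (P z x, G z x (i - r) a))"

definition I :: "(nat \<times> nat) set" where "I = {N} \<times> {..<r}"

definition J :: "(nat \<times> nat) set" where
  "J = {N} \<times> {r + 8..<r + 8 + s} \<union> {..<N} \<times> {r..<r + 8}"

lemma V_iff: "(x, a) \<in> V \<longleftrightarrow> x < N \<and> a < 12 \<or> x = N \<and> 12 \<le> a \<and> a < 12 + w"
  by (auto simp: V_def)

lemma F_infinity: "F (N, i) (x, a) = (x, f i a)"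
  by (simp add: F_def)

lemma F_local: "z < N \<Longrightarrow> x = z \<or> x = N \<Longrightarrow> F (z, i) (x, a) = embed z (f i a)"
  by (auto simp: F_def)

lemma F_frame: "z < N \<Longrightarrow> x \<noteq> z \<Longrightarrow> x \<noteq> N \<Longrightarrow>
    F (z, i) (x, a) = (if G z x (i - r) a = 12 then (x, a) else (P z x, G z x (i - r) a))"
  by (auto simp: F_def)

lemma f_matching: "i < r \<Longrightarrow> matching_map {..<12 + w} (f i)"
  and f_star: "r \<le> i \<Longrightarrow> i < r + 8 + s \<Longrightarrow> star_map {..<12 + w} (f i)"
  and f_unique: "a < 12 + w \<Longrightarrow> b < 12 + w \<Longrightarrow> a \<noteq> b \<Longrightarrow>
    \<exists>!i. i < r + 8 + s \<and> (f i a = b \<or> f i b = a)"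
proof -
  show "i < r \<Longrightarrow> matching_map {..<12 + w} (f i)"
    "r \<le> i \<Longrightarrow> i < r + 8 + s \<Longrightarrow> star_map {..<12 + w} (f i)"
    using f_urd by (auto simp: urd_maps_def)
  assume "a < 12 + w" "b < 12 + w" "a \<noteq> b"
  moreover have "{..<r} \<union> {r..<r + 8 + s} = {..<r + 8 + s}" by auto
  ultimately show "\<exists>!i. i < r + 8 + s \<and> (f i a = b \<or> f i b = a)"
    using f_urd by (auto simp: urd_maps_def)
qed

text \<open>An injective self-map of a finite set is onto. The layer \<open>y\<close> found here is
  the one holding the leaves of the centres in \<open>x\<close>.\<close>

lemma P_surj_layer:
  assumes "z < N" "x < N" "x \<noteq> z"
  shows "\<exists>y<N. y \<noteq> z \<and> P z y = x"
proof -
  have "P z ` ({..<N} - {z}) \<subseteq> {..<N} - {z}"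
    using P_less[OF assms(1)] P_neq[OF assms(1)] by (simp add: image_subset_iff)
  moreover have "inj_on (P z) ({..<N} - {z})"
    by (rule inj_onI) (use P_inj_layer[OF assms(1)] in simp)
  ultimately have "P z ` ({..<N} - {z}) = {..<N} - {z}" by (intro endo_inj_surj) simp_all
  then have "x \<in> P z ` ({..<N} - {z})" using assms by auto
  then show ?thesis by auto
qed

text \<open>Same argument with the layer fixed and the class varying; together with
  \<open>P_inj_class\<close> it shows that every arc is used by exactly one class.\<close>

lemma P_surj_class:
  assumes "x < N" "y < N" "x \<noteq> y"
  shows "\<exists>z<N. y \<noteq> z \<and> P z y = x"
proof -
  have "(\<lambda>z. P z y) ` ({..<N} - {y}) \<subseteq> {..<N} - {y}"
    using P_less[OF _ assms(2)] P_neq[OF _ assms(2)] by (simp add: image_subset_iff eq_commute)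
  moreover have "inj_on (\<lambda>z. P z y) ({..<N} - {y})"
    by (rule inj_onI) (use P_inj_class[OF assms(2)] in \<open>simp add: eq_commute\<close>)
  ultimately have "(\<lambda>z. P z y) ` ({..<N} - {y}) = {..<N} - {y}" by (intro endo_inj_surj) simp_all
  then have "x \<in> (\<lambda>z. P z y) ` ({..<N} - {y})" using assms by auto
  then show ?thesis by auto
qed

text \<open>The parent of \<open>b\<close> has at least one child, and \<open>G_children\<close>
  grants children to centres only.\<close>

lemma G_parent:
  assumes "z < N" "y < N" "y \<noteq> z" "k < 8" "b < 12" "G z y k b \<noteq> 12"
  shows "G z y k b < 12" "G z (P z y) k (G z y k b) = 12"
proof -
  show *: "G z y k b < 12" using G_le[OF assms(1-5)] assms(6) by simp
  have "b \<in> {b'. b' < 12 \<and> G z y k b' = G z y k b}" using assms by simp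
  then have "card {b'. b' < 12 \<and> G z y k b' = G z y k b} \<noteq> 0"
    by (subst card_0_eq) auto
  then show "G z (P z y) k (G z y k b) = 12"
    using G_children[OF assms(1-4) *] by (auto split: if_splits)
qed

section \<open>Each class is a perfect matching or a star factor\<close>

lemma matching_map_F:
  assumes "i < r"
  shows "matching_map V (F (N, i))"
  unfolding matching_map_def
proof
  fix p assume "p \<in> V"
  then obtain x a where p: "p = (x, a)" "(x, a) \<in> V" by (cases p) auto
  then have a: "a < 12 + w" by (auto simp: V_iff)
  show "F (N, i) p \<in> V \<and> F (N, i) p \<noteq> p \<and> F (N, i) (F (N, i) p) = p"
    using p a matching_mapD[OF f_matching[OF assms], of a] f_preserves[of i a] assms
    by (auto simp: F_infinity V_iff not_less)
qed

lemma star_map_F_infinity: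
  assumes "r + 8 \<le> i" "i < r + 8 + s"
  shows "star_map V (F (N, i))"
  unfolding star_map_def
proof (intro conjI ballI impI)
  have st: "star_map {..<12 + w} (f i)" using f_star assms by simp
  have pres: "f i a < 12 \<longleftrightarrow> a < 12" if "a < 12 + w" for a using f_preserves that assms by simp
  {
    fix p assume "p \<in> V"
    then obtain x a where p: "p = (x, a)" "(x, a) \<in> V" by (cases p) auto
    then have a: "a < 12 + w" by (auto simp: V_iff)
    show "F (N, i) p \<in> V"
      using p a star_mapD[OF st, of a] pres[of a] by (auto simp: F_infinity V_iff not_less)
    show "F (N, i) (F (N, i) p) = F (N, i) p"
      using p a star_mapD[OF st, of a] by (auto simp: F_infinity)
  next
    fix p assume "p \<in> V" and fp: "F (N, i) p = p"
    then obtain x a where p: "p = (x, a)" "(x, a) \<in> V" by (cases p) auto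
    then have a: "a < 12 + w" by (auto simp: V_iff)
    have "f i a = a" using fp p by (simp add: F_infinity)
    then have "card {b \<in> {..<12 + w}. b \<noteq> a \<and> f i b = a} = 3"
      using star_map_leaves[OF st] a by auto
    moreover have "{q \<in> V. q \<noteq> p \<and> F (N, i) q = p} =
        Pair x ` {b \<in> {..<12 + w}. b \<noteq> a \<and> f i b = a}"
    proof (intro equalityI subsetI)
      fix q assume "q \<in> {q \<in> V. q \<noteq> p \<and> F (N, i) q = p}"
      then show "q \<in> Pair x ` {b \<in> {..<12 + w}. b \<noteq> a \<and> f i b = a}"
        using p by (cases q) (auto simp: F_infinity V_iff)
    next
      fix q assume "q \<in> Pair x ` {b \<in> {..<12 + w}. b \<noteq> a \<and> f i b = a}"
      then obtain b where b: "q = (x, b)" "b < 12 + w" "b \<noteq> a" "f i b = a" by auto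
      then show "q \<in> {q \<in> V. q \<noteq> p \<and> F (N, i) q = p}"
        using p pres[of b] by (simp add: F_infinity V_iff) linarith
    qed
    ultimately show "card {q \<in> V. q \<noteq> p \<and> F (N, i) q = p} = 3"
      by (simp add: card_image inj_on_def)
  }
qed

lemma embed_in_V: "z < N \<Longrightarrow> a < 12 + w \<Longrightarrow> embed z a \<in> V"
  by (auto simp: embed_def V_iff)

lemma V_local: "(x, a) \<in> V \<Longrightarrow> z < N \<Longrightarrow> x = z \<or> x = N \<Longrightarrow> (x, a) = embed z a \<and> a < 12 + w"
  by (auto simp: embed_def V_iff)

lemma F_embed: "z < N \<Longrightarrow> F (z, i) (embed z a) = embed z (f i a)"
  by (simp add: embed_def F_local)

lemma embed_eq_iff: "embed z a = embed z b \<longleftrightarrow> a = b"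
  by (auto simp: embed_def)

lemma fst_F_frame:
  assumes "z < N" "y < N" "y \<noteq> z"
  shows "fst (F (z, i) (y, b)) \<noteq> z" "fst (F (z, i) (y, b)) < N"
  using assms P_less[OF assms] P_neq[OF assms] by (auto simp: F_frame)

text \<open>Layer \<open>z\<close> with the points at infinity is closed under the map, and so is
  the set of the other layers. On the former the claim is that of the local design; on the latter
  all leaves of a centre lie in the one layer whose predecessor is the layer of that centre.\<close>

lemma star_map_F_frame:
  assumes "z < N" "k < 8"
  shows "star_map V (F (z, r + k))"
  unfolding star_map_def
proof (intro conjI ballI impI)
  have st: "star_map {..<12 + w} (f (r + k))" using f_star assms by simp
  {
    fix p assume "p \<in> V"
    then obtain x a where p: "p = (x, a)" "(x, a) \<in> V" by (cases p) auto
    have "F (z, r + k) p \<in> V \<and> F (z, r + k) (F (z, r + k) p) = F (z, r + k) p"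
    proof (cases "x = z \<or> x = N")
      case True
      then have a: "p = embed z a" "a < 12 + w" using V_local[OF p(2) assms(1) True] p by auto
      then show ?thesis
        using star_mapD[OF st, of a] assms by (auto simp: F_embed embed_in_V)
    next
      case False
      then have x: "x < N" "x \<noteq> z" "x \<noteq> N" "a < 12" using p by (auto simp: V_iff)
      have "P z x \<noteq> N" using P_less[OF assms(1) x(1,2)] by simp
      then show ?thesis
        using x p assms G_parent[of z x k a] P_less[OF assms(1) x(1,2)] P_neq[OF assms(1) x(1,2)]
        by (auto simp: F_frame V_iff)
    qed
    then show "F (z, r + k) p \<in> V" "F (z, r + k) (F (z, r + k) p) = F (z, r + k) p" by auto
  next
    fix p assume "p \<in> V" and fp: "F (z, r + k) p = p"
    then obtain x a where p: "p = (x, a)" "(x, a) \<in> V" by (cases p) auto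
    show "card {q \<in> V. q \<noteq> p \<and> F (z, r + k) q = p} = 3"
    proof (cases "x = z \<or> x = N")
      case True
      then have a: "p = embed z a" "a < 12 + w" using V_local[OF p(2) assms(1) True] p by auto
      have "f (r + k) a = a" using fp assms by (simp add: a F_embed embed_eq_iff)
      then have "card {b \<in> {..<12 + w}. b \<noteq> a \<and> f (r + k) b = a} = 3"
        using star_map_leaves[OF st] a by auto
      moreover have "{q \<in> V. q \<noteq> p \<and> F (z, r + k) q = p} =
          embed z ` {b \<in> {..<12 + w}. b \<noteq> a \<and> f (r + k) b = a}"
      proof (intro equalityI subsetI)
        fix q assume q: "q \<in> {q \<in> V. q \<noteq> p \<and> F (z, r + k) q = p}"
        obtain y b where yb: "q = (y, b)" by (cases q)
        have "y = z \<or> y = N"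
          using q yb True fst_F_frame[of z y "r + k" b] assms p by (auto simp: V_iff)
        then have "q = embed z b" "b < 12 + w" using V_local[of y b z] q yb assms by auto
        then show "q \<in> embed z ` {b \<in> {..<12 + w}. b \<noteq> a \<and> f (r + k) b = a}"
          using q a assms by (auto simp: F_embed embed_eq_iff)
      next
        fix q assume "q \<in> embed z ` {b \<in> {..<12 + w}. b \<noteq> a \<and> f (r + k) b = a}"
        then show "q \<in> {q \<in> V. q \<noteq> p \<and> F (z, r + k) q = p}"
          using a assms by (auto simp: F_embed embed_eq_iff embed_in_V)
      qed
      ultimately show ?thesis by (simp add: card_image inj_on_def embed_eq_iff)
    next
      case False
      then have x: "x < N" "x \<noteq> z" "x \<noteq> N" "a < 12" using p by (auto simp: V_iff)
      obtain y where y: "y < N" "y \<noteq> z" "P z y = x" using P_surj_layer[OF assms(1) x(1,2)] by auto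
      have g: "G z x k a = 12"
      proof (rule ccontr)
        assume "G z x k a \<noteq> 12"
        then have "P z x = x" using fp x p assms by (auto simp: F_frame)
        then show False using P_neq[OF assms(1) x(1,2)] by simp
      qed
      have "{q \<in> V. q \<noteq> p \<and> F (z, r + k) q = p} = Pair y ` {b. b < 12 \<and> G z y k b = a}"
      proof (intro equalityI subsetI)
        fix q assume q: "q \<in> {q \<in> V. q \<noteq> p \<and> F (z, r + k) q = p}"
        obtain u b where ub: "q = (u, b)" by (cases q)
        have loc: "\<not> (u = z \<or> u = N)"
          using q x p assms(1) by (auto simp: ub F_local embed_def split: if_splits)
        then have u: "u < N" "b < 12" "u \<noteq> z" "u \<noteq> N" using q ub by (auto simp: V_iff)
        have "P z u = x" "G z u k b = a"
          using q u p assms(1) by (auto simp: ub F_frame split: if_splits)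
        then show "q \<in> Pair y ` {b. b < 12 \<and> G z y k b = a}"
          using P_inj_layer[OF assms(1), of u y] u y ub by auto
      next
        fix q assume "q \<in> Pair y ` {b. b < 12 \<and> G z y k b = a}"
        then obtain b where b: "q = (y, b)" "b < 12" "G z y k b = a" by auto
        show "q \<in> {q \<in> V. q \<noteq> p \<and> F (z, r + k) q = p}"
          using b y x p assms P_neq[OF assms(1) y(1,2)] by (auto simp: V_iff F_frame)
      qed
      moreover have "card {b. b < 12 \<and> G z y k b = a} = 3"
        using G_children[OF assms(1) y(1,2) assms(2) x(4)] g y(3) by simp
      ultimately show ?thesis by (simp add: card_image inj_on_def)
    qed
  }
qed

section \<open>Each edge lies in exactly one class\<close>

abbreviation joins :: "nat \<times> nat \<Rightarrow> nat \<times> nat \<Rightarrow> nat \<times> nat \<Rightarrow> bool" where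
  "joins c p q \<equiv> c \<in> I \<union> J \<and> (F c p = q \<or> F c q = p)"

lemma class_cases [consumes 1, case_names infinity frame]:
  assumes "c \<in> I \<union> J"
  obtains i where "c = (N, i)" "i < r \<or> r + 8 \<le> i \<and> i < r + 8 + s"
  | z k where "c = (z, r + k)" "z < N" "k < 8"
proof -
  obtain z i where c: "c = (z, i)" by (cases c)
  show ?thesis
  proof (cases "z = N")
    case True then show ?thesis using assms c that(1)[of i] by (auto simp: I_def J_def)
  next
    case False
    then have "i = r + (i - r)" "z < N" "i - r < 8" using assms c by (auto simp: I_def J_def)
    then show ?thesis using c that(2)[of z "i - r"] by metis
  qed
qed

lemma class_intros:
  "i < r \<or> r + 8 \<le> i \<and> i < r + 8 + s \<Longrightarrow> (N, i) \<in> I \<union> J"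
  "z < N \<Longrightarrow> r \<le> i \<Longrightarrow> i < r + 8 \<Longrightarrow> (z, i) \<in> I \<union> J"
  by (auto simp: I_def J_def)

text \<open>All local designs contain this edge, but never in one of the eight classes tied to a
  layer, by \<open>f_hole\<close>; so only a class shared by all layers remains.\<close>

lemma joins_infinity:
  assumes ab: "12 \<le> a" "a < 12 + w" "12 \<le> b" "b < 12 + w" "a \<noteq> b"
  shows "\<exists>!c. joins c (N, a) (N, b)"
proof -
  obtain i where i: "i < r + 8 + s" "f i a = b \<or> f i b = a"
    and u: "\<And>j. j < r + 8 + s \<Longrightarrow> f j a = b \<or> f j b = a \<Longrightarrow> j = i"
    using f_unique[of a b] ab by blast
  have no: False if "r \<le> j" "j < r + 8" "f j a = b \<or> f j b = a" for j
    using f_hole[OF that(1,2), of a] f_hole[OF that(1,2), of b] that(3) ab by auto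
  show ?thesis
  proof (rule ex1I[of _ "(N, i)"])
    show "joins (N, i) (N, a) (N, b)"
    proof -
      have "i < r \<or> r + 8 \<le> i \<and> i < r + 8 + s" using no[OF _ _ i(2)] i(1) by (cases "i < r"; cases "i < r + 8") auto
      then show ?thesis using class_intros(1)[of i] i by (simp add: F_infinity)
    qed
  next
    fix c assume c: "joins c (N, a) (N, b)"
    then have "c \<in> I \<union> J" by blast
    then show "c = (N, i)"
    proof (cases rule: class_cases)
      case (infinity j) then show ?thesis using c u[of j] by (auto simp: F_infinity)
    next
      case (frame z k)
      then show ?thesis using c no[of "r + k"] by (auto simp: F_local embed_def split: if_splits)
    qed
  qed
qed

text \<open>The local design puts the edge into a class \<open>i\<close>, which is realised as
  \<open>(z, i)\<close> if it is one of the eight and as \<open>(N, i)\<close> otherwise.\<close>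

lemma joins_local:
  assumes z: "z < N" and ab: "a < 12" "b < 12 + w" "a \<noteq> b"
  shows "\<exists>!c. joins c (z, a) (embed z b)"
proof -
  have a: "a < 12 + w" using ab(1) by simp
  obtain i where i: "i < r + 8 + s" "f i a = b \<or> f i b = a"
    and u: "\<And>j. j < r + 8 + s \<Longrightarrow> f j a = b \<or> f j b = a \<Longrightarrow> j = i"
    using f_unique[OF a ab(2,3)] by blast
  have za: "(z, a) = embed z a" using ab by (simp add: embed_def)
  define c0 where "c0 = (if r \<le> i \<and> i < r + 8 then z else N, i)"
  have c0: "c0 \<in> I \<union> J" using i z class_intros(1)[of i] class_intros(2)[of z i]
    by (auto simp: c0_def)
  show ?thesis
  proof (rule ex1I[of _ c0])
    show "joins c0 (z, a) (embed z b)"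
    proof (cases "r \<le> i \<and> i < r + 8")
      case True
      then show ?thesis using c0 i z by (auto simp: c0_def za F_embed)
    next
      case False
      then have "i < r \<or> r + 8 \<le> i \<and> i < r + 8 + s" using i by auto
      note pres = f_preserves[OF this]
      \<comment> \<open>A class that splits along the hole has no edge from the layer to
        infinity.\<close>
      have "b < 12" using pres[of a] pres[of b] i ab by auto
      then show ?thesis using c0 i False by (auto simp: c0_def embed_def F_infinity)
    qed
  next
    fix c assume c: "joins c (z, a) (embed z b)"
    then have "c \<in> I \<union> J" by blast
    then show "c = c0"
    proof (cases rule: class_cases)
      case (infinity j)
      then have "f j a = b \<or> f j b = a" using c by (auto simp: embed_def F_infinity)
      then have "j = i" using u infinity by auto
      then show ?thesis using infinity by (auto simp: c0_def)
    next
      case (frame z' k)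
      have "z' = z"
      proof (rule ccontr)
        assume ne: "z' \<noteq> z"
        \<comment> \<open>In a class missing another layer, a point of layer \<open>z\<close> is a
          centre or is sent to a different layer, and by \<open>e\<close> a point at infinity is not
          sent to layer \<open>z\<close> either.\<close>
        have d: "fst (F (z', r + k) (z, d)) < N \<and>
            (fst (F (z', r + k) (z, d)) \<noteq> z \<or> F (z', r + k) (z, d) = (z, d))" for d
          using P_less[of z' z] P_neq[of z' z] ne frame z by (auto simp: F_frame)
        have e: "F (z', r + k) (N, b) \<noteq> (z, a)"
          using frame ne z by (auto simp: F_local embed_def)
        show False
          using c frame d[of a] d[of b] e ab by (auto simp: embed_def split: if_splits)
      qed
      then have "f (r + k) a = b \<or> f (r + k) b = a" using c frame
        by (auto simp: za F_embed embed_eq_iff)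
      then have "r + k = i" using u frame by auto
      then show ?thesis using frame \<open>z' = z\<close> by (auto simp: c0_def)
    qed
  qed
qed

lemma F_arc_iff:
  assumes "x < N" "y < N" "x \<noteq> y" "a < 12" "b < 12" "z < N" "k < 8"
  shows "F (z, r + k) (y, b) = (x, a) \<longleftrightarrow> z \<noteq> y \<and> P z y = x \<and> G z y k b = a"
proof (cases "z = y")
  case True then show ?thesis using assms by (auto simp: F_local embed_def)
next
  case False
  then show ?thesis using assms G_parent[of z y k b] by (auto simp: F_frame)
qed

text \<open>Only the two opposite arcs between the layers can carry the edge. Each lies in one
  class, \<open>z\<close> and \<open>z'\<close> (possibly equal), and \<open>G_cover\<close> leaves
  a single partial class among both.\<close>

lemma joins_frame:
  assumes xy: "x < N" "y < N" "x \<noteq> y" and ab: "a < 12" "b < 12"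
  shows "\<exists>!c. joins c (x, a) (y, b)"
proof -
  obtain z where z: "z < N" "y \<noteq> z" "P z y = x" using P_surj_class[OF xy] by auto
  obtain z' where z': "z' < N" "x \<noteq> z'" "P z' x = y" using P_surj_class[of y x] xy by auto
  define K K' where "K = {k. k < 8 \<and> G z y k b = a}" and "K' = {k. k < 8 \<and> G z' x k a = b}"
  have fin: "finite K" "finite K'" by (auto simp: K_def K'_def)
  have card: "card K + card K' = 1"
    using G_cover[of x y z z'] xy ab z z' by (auto simp: K_def K'_def)
  have iff: "joins c (x, a) (y, b) \<longleftrightarrow>
      c \<in> (\<lambda>k. (z, r + k)) ` K \<union> (\<lambda>k. (z', r + k)) ` K'" for c
  proof
    assume c: "joins c (x, a) (y, b)"
    then have "c \<in> I \<union> J" by blast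
    then show "c \<in> (\<lambda>k. (z, r + k)) ` K \<union> (\<lambda>k. (z', r + k)) ` K'"
    proof (cases rule: class_cases)
      case (infinity i) then show ?thesis using c xy by (auto simp: F_infinity)
    next
      case (frame u k)
      have "u = z" if "u \<noteq> y" "P u y = x" using P_inj_class[of y u z] that z xy frame by auto
      moreover have "u = z'" if "u \<noteq> x" "P u x = y"
        using P_inj_class[of x u z'] that z' xy frame by auto
      moreover have "(u \<noteq> y \<and> P u y = x \<and> G u y k b = a) \<or> (u \<noteq> x \<and> P u x = y \<and> G u x k a = b)"
        using c frame F_arc_iff[OF xy ab frame(2,3)] xy ab
          F_arc_iff[of y x b a u k] by auto
      ultimately show ?thesis using frame by (auto simp: K_def K'_def)
    qed
  next
    assume "c \<in> (\<lambda>k. (z, r + k)) ` K \<union> (\<lambda>k. (z', r + k)) ` K'"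
    then show "joins c (x, a) (y, b)"
    proof
      assume "c \<in> (\<lambda>k. (z, r + k)) ` K"
      then obtain k where "c = (z, r + k)" "k < 8" "G z y k b = a" by (auto simp: K_def)
      then show ?thesis
        using F_arc_iff[OF xy ab z(1), of k] z class_intros(2)[of z "r + k"] by auto
    next
      assume "c \<in> (\<lambda>k. (z', r + k)) ` K'"
      then obtain k where "c = (z', r + k)" "k < 8" "G z' x k a = b" by (auto simp: K'_def)
      then show ?thesis
        using F_arc_iff[of y x b a z' k] xy ab z' class_intros(2)[of z' "r + k"] by auto
    qed
  qed
  have "card K = 1 \<and> K' = {} \<or> K = {} \<and> card K' = 1"
    using card fin by (cases "card K") auto
  then obtain c where "(\<lambda>k. (z, r + k)) ` K \<union> (\<lambda>k. (z', r + k)) ` K' = {c}"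
    by (auto simp: card_1_singleton_iff)
  then show ?thesis unfolding iff by auto
qed

lemma urd_maps_F: "urd_maps V I J F"
  unfolding urd_maps_def
proof (intro conjI ballI impI)
  show "finite V" "finite I" "finite J" "I \<inter> J = {}" by (auto simp: V_def I_def J_def)
  show "matching_map V (F c)" if "c \<in> I" for c
    using that matching_map_F by (auto simp: I_def)
  show "star_map V (F c)" if "c \<in> J" for c
  proof -
    have "c \<in> I \<union> J" using that by blast
    then show ?thesis
    proof (cases rule: class_cases)
      case (infinity i)
      then show ?thesis using that star_map_F_infinity[of i] by (auto simp: J_def)
    next
      case (frame z k) then show ?thesis using star_map_F_frame by auto
    qed
  qed
  fix p q assume pq: "p \<in> V" "q \<in> V" "p \<noteq> q"
  obtain x a y b where p: "p = (x, a)" and q: "q = (y, b)" by (cases p, cases q)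
  have sym: "\<exists>!c. joins c q p \<Longrightarrow> \<exists>!c. joins c p q" by (simp add: disj_commute)
  consider "x = N" "y = N" | "x < N" "y = x \<or> y = N" | "y < N" "x = y \<or> x = N"
    | "x < N" "y < N" "x \<noteq> y"
    using pq p q by (auto simp: V_iff)
  then show "\<exists>!c. joins c p q"
  proof cases
    case 1
    then have "12 \<le> a" "a < 12 + w" "12 \<le> b" "b < 12 + w" "a \<noteq> b"
      using pq by (auto simp: p q V_iff)
    from joins_infinity[OF this] show ?thesis unfolding p q 1 .
  next
    case 2
    then have q': "q = embed x b" "b < 12 + w" using V_local[of y b x] pq(2) q by auto
    have a: "a < 12" using 2(1) pq(1) p by (auto simp: V_iff)
    then have "a \<noteq> b" using q' p pq(3) by (auto simp: embed_def)
    from joins_local[OF 2(1) a q'(2) this] show ?thesis unfolding p q'(1) .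
  next
    case 3
    then have p': "p = embed y a" "a < 12 + w" using V_local[of x a y] pq(1) p by auto
    have b: "b < 12" using 3(1) pq(2) q by (auto simp: V_iff)
    then have "b \<noteq> a" using p' q pq(3) by (auto simp: embed_def)
    from joins_local[OF 3(1) b p'(2) this] have "\<exists>!c. joins c q p" unfolding q p'(1) .
    then show ?thesis by (rule sym)
  next
    case 4
    then have "a < 12" "b < 12" using pq by (auto simp: p q V_iff)
    from joins_frame[OF 4 this] show ?thesis unfolding p q .
  qed
qed

lemma exists_URD:
  assumes "0 < N"
  shows "exists_K2_K13_URD (12 * N + w) r (8 * N + s)"
proof -
  have "card V = 12 * N + w"
    unfolding V_def by (subst card_Un_disjoint) (auto simp: card_cartesian_product)
  moreover have "card I = r" by (simp add: I_def card_cartesian_product)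
  moreover have "card J = 8 * N + s"
    unfolding J_def by (subst card_Un_disjoint) (auto simp: card_cartesian_product)
  moreover have "(0, 0) \<in> V" using assms by (simp add: V_iff)
  ultimately show ?thesis using urd_maps_imp_exists[OF urd_maps_F] by fastforce
qed

end

section \<open>Partitions of the complete digraph into near-permutations\<close>

text \<open>\<open>mirror n z y\<close> is \<open>2 z - y\<close> modulo \<open>n\<close>, \<open>halfway n z\<close> is \<open>z + (n - 1) / 2\<close> modulo \<open>n\<close>.\<close>

definition mirror :: "nat \<Rightarrow> nat \<Rightarrow> nat \<Rightarrow> nat" where
  "mirror n z y =
     (if 2 * z < y then 2 * z + n - y else if 2 * z - y < n then 2 * z - y else 2 * z - y - n)"

definition halfway :: "nat \<Rightarrow> nat \<Rightarrow> nat" where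
  "halfway n z = (if z + n div 2 < n then z + n div 2 else z + n div 2 - n)"

definition prev :: "nat \<Rightarrow> nat \<Rightarrow> nat" where
  "prev n y = (if y = 0 then n - 1 else y - 1)"

definition succ :: "nat \<Rightarrow> nat \<Rightarrow> nat" where
  "succ n y = (if y + 1 = n then 0 else y + 1)"

section \<open>Reflections modulo an odd number\<close>

lemma mirror_less: "z < n \<Longrightarrow> y < n \<Longrightarrow> mirror n z y < n"
  by (auto simp: mirror_def)

lemma mirror_mirror: "z < n \<Longrightarrow> y < n \<Longrightarrow> mirror n z (mirror n z y) = y"
  by (auto simp: mirror_def)

lemma mirror_inj: "z < n \<Longrightarrow> y < n \<Longrightarrow> y' < n \<Longrightarrow> mirror n z y = mirror n z y' \<Longrightarrow> y = y'"
  by (metis mirror_mirror)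

lemma mirror_eq_centre: "z < n \<Longrightarrow> y < n \<Longrightarrow> mirror n z y = z \<Longrightarrow> y = z"
  by (auto simp: mirror_def split: if_splits)

lemma mirror_cases: "z < n \<Longrightarrow> y < n \<Longrightarrow>
    mirror n z y + y = 2 * z \<or> mirror n z y + y = 2 * z + n \<or> mirror n z y + y + n = 2 * z"
  by (auto simp: mirror_def)

text \<open>Doubling is injective modulo an odd number: 2 z and 2 z' differ by 0, \<open>n\<close>
  or 2 \<open>n\<close> in absolute value; parity excludes \<open>n\<close> and the range excludes 2
  \<open>n\<close>.\<close>

lemma mirror_inj_centre:
  assumes "odd n" "z < n" "z' < n" "y < n" "mirror n z y = mirror n z' y"
  shows "z = z'"
proof -
  obtain h where h: "n = 2 * h + 1" using assms(1) by (rule oddE)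
  define v where "v = mirror n z y"
  have "v + y = 2 * z \<or> v + y = 2 * z + n \<or> v + y + n = 2 * z"
    "v + y = 2 * z' \<or> v + y = 2 * z' + n \<or> v + y + n = 2 * z'"
    using mirror_cases[OF assms(2,4)] mirror_cases[OF assms(3,4)] assms(5) by (simp_all add: v_def)
  then show ?thesis using assms(2,3) h by (elim disjE) (simp_all, presburger+)
qed

lemma mirror_fixed:
  assumes "odd n" "z < n" "y < n" "mirror n z y = y"
  shows "y = z"
proof -
  have "mirror n z y = mirror n y y" using assms(3,4) by (simp add: mirror_def)
  then show ?thesis using mirror_inj_centre[OF assms(1,2,3,3)] by simp
qed

lemma prev_less: "y < n \<Longrightarrow> prev n y < n"
  and succ_less: "y < n \<Longrightarrow> succ n y < n"
  and prev_succ: "y < n \<Longrightarrow> prev n (succ n y) = y"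
  by (auto simp: prev_def succ_def)

lemma halfway_less: "z < n \<Longrightarrow> halfway n z < n"
  by (auto simp: halfway_def)

lemma halfway_inj: "z < n \<Longrightarrow> z' < n \<Longrightarrow> halfway n z = halfway n z' \<Longrightarrow> z = z'"
  by (auto simp: halfway_def split: if_splits)

lemma halfway_neq: "1 < n \<Longrightarrow> z < n \<Longrightarrow> halfway n z \<noteq> z"
  by (auto simp: halfway_def)

lemma succ_halfway_neq:
  assumes "odd n" "1 < n" "z < n"
  shows "succ n (halfway n z) \<noteq> z"
proof -
  obtain h where "n = 2 * h + 1" using assms(1) by (rule oddE)
  then show ?thesis using assms(2-) by (auto simp: halfway_def succ_def)
qed

lemma mirror_halfway:
  assumes "odd n" "z < n"
  shows "mirror n z (halfway n z) = succ n (halfway n z)"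
proof -
  obtain h where "n = 2 * h + 1" using assms(1) by (rule oddE)
  then show ?thesis using assms(2) by (auto simp: mirror_def halfway_def succ_def)
qed

text \<open>From y + (y - 1) = 2 z modulo \<open>n\<close> follows y = z + (n + 1) / 2. With
  \<open>mirror_halfway\<close>, each reflection thus contains exactly one arc of the rotation, the
  one that \<open>even_pred\<close> reroutes through layer \<open>n\<close>.\<close>

lemma mirror_eq_prev:
  assumes "odd n" "z < n" "y < n" "mirror n z y = prev n y"
  shows "y = succ n (halfway n z)"
proof -
  obtain h where h: "n = 2 * h + 1" using assms(1) by (rule oddE)
  have hd: "n div 2 = h" using h by simp
  have c: "prev n y + y = 2 * z \<or> prev n y + y = 2 * z + n \<or> prev n y + y + n = 2 * z"
    using mirror_cases[OF assms(2,3)] assms(4) by simp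
  show ?thesis
  proof (cases "y = 0")
    case True
    then have "z = h" using c assms(2) h by (auto simp: prev_def)
    then show ?thesis using True h hd by (simp add: halfway_def succ_def)
  next
    case False
    then obtain t where t: "y = Suc t" using not0_implies_Suc by auto
    then have "t + Suc t = 2 * z \<or> t = z + h \<or> z = t + h + 1"
      using c h by (auto simp: prev_def)
    moreover have "t + Suc t \<noteq> 2 * z" by presburger
    ultimately consider "y = z + h + 1" | "z = y + h" using t by auto
    then show ?thesis
    proof cases
      case 1 then show ?thesis using assms(3) by (simp add: halfway_def succ_def hd)
    next
      case 2
      then have "halfway n z = y - 1" using False h by (simp add: halfway_def hd)
      then show ?thesis using False assms(3) by (simp add: succ_def)
    qed
  qed
qed

definition arc_compatible ::
  "(nat \<Rightarrow> nat \<Rightarrow> nat \<Rightarrow> nat) \<Rightarrow> nat \<Rightarrow> nat \<Rightarrow> bool" where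
  "arc_compatible T i j \<longleftrightarrow> (\<forall>k<8. \<forall>a<12. T j k a \<le> 12 \<and>
     card {b. b < 12 \<and> T j k b = a} = (if T i k a = 12 then 3 else 0))"

definition arc_complementary ::
  "(nat \<Rightarrow> nat \<Rightarrow> nat \<Rightarrow> nat) \<Rightarrow> nat \<Rightarrow> nat \<Rightarrow> bool" where
  "arc_complementary T i j \<longleftrightarrow> (\<forall>a<12. \<forall>b<12.
     card {k. k < 8 \<and> T i k b = a} + card {k. k < 8 \<and> T j k a = b} = 1)"

lemma arc_complementary_sym: "arc_complementary T i j \<Longrightarrow> arc_complementary T j i"
  by (auto simp: arc_complementary_def add.commute)

text \<open>\<open>T i\<close> describes the arcs of kind \<open>i\<close> from a layer to the next one: \<open>T i k b\<close> is the centre of the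
  star containing the point \<open>b\<close> of the second layer in partial class \<open>k\<close>, or \<open>12\<close> if \<open>b\<close> is itself a
  centre. Kinds 0 and 1 are the two arcs of a 2-cycle, kinds 2 to 5 occur on an odd cycle whose layers
  are coloured \<open>0, 1, 0, 1, \<dots>, 0, 1, 2\<close>, and kinds 6 to 8 are the arcs of a 3-cycle. Compatibility
  concerns consecutive arcs, complementarity the two arcs joining the same pair of layers.\<close>

locale arc_system =
  fixes T :: "nat \<Rightarrow> nat \<Rightarrow> nat \<Rightarrow> nat"
  assumes compatible: "(i, j) \<in> {(0,1), (1,0), (4,5), (5,2), (2,3), (3,2), (2,4), (8,6), (6,7), (7,8)} \<Longrightarrow>
      arc_compatible T i j"
    and complementary: "(i, j) \<in> {(0,1), (6,7), (8,2), (8,3), (8,4), (8,5)} \<Longrightarrow>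
      arc_complementary T i j"

text \<open>This separates the permutations of layers from the tables for points:
  \<open>idx z y\<close> is the kind of the arc entering layer \<open>y\<close> in class
  \<open>z\<close>.\<close>

lemma frame_fillingI:
  fixes idx :: "nat \<Rightarrow> nat \<Rightarrow> nat"
  assumes "subsystem w r s f"
    and range: "\<And>z y. \<lbrakk>z < N; y < N; y \<noteq> z\<rbrakk> \<Longrightarrow> P z y < N \<and> P z y \<noteq> z \<and> P z y \<noteq> y"
    and inj_layer: "\<And>z y y'. \<lbrakk>z < N; y < N; y \<noteq> z; y' < N; y' \<noteq> z; P z y = P z y'\<rbrakk> \<Longrightarrow> y = y'"
    and inj_class: "\<And>y z z'. \<lbrakk>y < N; z < N; y \<noteq> z; z' < N; y \<noteq> z'; P z y = P z' y\<rbrakk> \<Longrightarrow> z = z'"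
    and compat: "\<And>z y. \<lbrakk>z < N; y < N; y \<noteq> z\<rbrakk> \<Longrightarrow> arc_compatible T (idx z (P z y)) (idx z y)"
    and compl: "\<And>x y z z'. \<lbrakk>x < N; y < N; z < N; z' < N; y \<noteq> z; x \<noteq> z'; P z y = x; P z' x = y\<rbrakk> \<Longrightarrow>
      arc_complementary T (idx z y) (idx z' x)"
  shows "frame_filling w r s f N P (\<lambda>z y. T (idx z y))"
proof -
  interpret subsystem w r s f by fact
  show ?thesis
  proof
    show "T (idx z y) k a \<le> 12" if "z < N" "y < N" "y \<noteq> z" "k < 8" "a < 12" for z y k a
      using compat[OF that(1-3)] that by (auto simp: arc_compatible_def)
    show "card {b. b < 12 \<and> T (idx z y) k b = a} = (if T (idx z (P z y)) k a = 12 then 3 else 0)"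
      if "z < N" "y < N" "y \<noteq> z" "k < 8" "a < 12" for z y k a
      using compat[OF that(1-3)] that by (auto simp: arc_compatible_def)
    show "card {k. k < 8 \<and> T (idx z y) k b = a} + card {k. k < 8 \<and> T (idx z' x) k a = b} = 1"
      if "x < N" "y < N" "z < N" "z' < N" "y \<noteq> z" "x \<noteq> z'" "P z y = x" "P z' x = y" "a < 12" "b < 12"
      for x y z z' a b
      using compl[OF that(1-8)] that by (auto simp: arc_complementary_def)
  qed (rule inj_layer inj_class range[THEN conjunct1] range[THEN conjunct2]; assumption)+
qed

text \<open>The two arcs of a 2-cycle need different kinds; the order of the layers breaks the
  symmetry.\<close>

definition odd_idx :: "nat \<Rightarrow> nat \<Rightarrow> nat \<Rightarrow> nat" where
  "odd_idx n z y = (if y < mirror n z y then 1 else 0)"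

text \<open>The layers are the residues modulo \<open>n\<close> and a further layer \<open>n\<close>. The class \<open>z = n\<close> is the rotation;
  for \<open>z < n\<close> the reflection in \<open>z\<close> exchanges \<open>halfway n z\<close> and its successor, and the extra layer is
  inserted between the two. In this way the reflections give up exactly the arcs of the rotation.\<close>

definition even_pred :: "nat \<Rightarrow> nat \<Rightarrow> nat \<Rightarrow> nat" where
  "even_pred n z y =
     (if z = n then prev n y
      else if y = n then halfway n z
      else if y = succ n (halfway n z) then n
      else mirror n z y)"

text \<open>In the rotation, layer \<open>n - 1\<close> has the third colour: kind 4 enters it and
  kind 5 leads on to layer 0. In class \<open>z < n\<close> the 3-cycle runs from
  \<open>halfway n z\<close> to \<open>n\<close>, to the successor of \<open>halfway n z\<close>,
  and back, with kinds 6, 7, 8.\<close>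

definition even_idx :: "nat \<Rightarrow> nat \<Rightarrow> nat \<Rightarrow> nat" where
  "even_idx n z y =
     (if z = n then (if y = 0 then 5 else if y = n - 1 then 4 else if odd y then 2 else 3)
      else if y = n then 6
      else if y = succ n (halfway n z) then 7
      else if y = halfway n z then 8
      else odd_idx n z y)"

context arc_system
begin

section \<open>Frames with an odd and with an even number of layers\<close>

lemma arc_complementary_odd_idx:
  assumes "odd n" "z < n" "y < n" "y \<noteq> z"
  shows "arc_complementary T (odd_idx n z y) (odd_idx n z (mirror n z y))"
proof -
  have "mirror n z y \<noteq> y" using mirror_fixed[OF assms(1-3)] assms(4) by auto
  then show ?thesis
    using assms complementary[of 0 1] arc_complementary_sym[OF complementary[of 0 1]]
    by (auto simp: odd_idx_def mirror_mirror)
qed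

lemma arc_compatible_odd_idx:
  assumes "odd n" "z < n" "y < n" "y \<noteq> z"
  shows "arc_compatible T (odd_idx n z (mirror n z y)) (odd_idx n z y)"
proof -
  have "mirror n z y \<noteq> y" using mirror_fixed[OF assms(1-3)] assms(4) by auto
  then show ?thesis
    using assms compatible[of 0 1] compatible[of 1 0] by (auto simp: odd_idx_def mirror_mirror)
qed

text \<open>A reflection is an involution, so opposite arcs lie in the same class and form a 2-cycle
  there.\<close>

lemma frame_filling_odd:
  assumes "odd n" and "subsystem w r s f"
  shows "frame_filling w r s f n (mirror n) (\<lambda>z y. T (odd_idx n z y))"
proof (rule frame_fillingI[OF assms(2)])
  show "mirror n z y < n \<and> mirror n z y \<noteq> z \<and> mirror n z y \<noteq> y" if "z < n" "y < n" "y \<noteq> z" for z y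
    using that mirror_less mirror_eq_centre mirror_fixed assms(1) by metis
  show "y = y'" if "z < n" "y < n" "y' < n" "mirror n z y = mirror n z y'" for z y y'
    using that by (rule mirror_inj)
  show "z = z'" if "y < n" "z < n" "z' < n" "mirror n z y = mirror n z' y" for y z z'
    using mirror_inj_centre[OF assms(1)] that by blast
  show "arc_compatible T (odd_idx n z (mirror n z y)) (odd_idx n z y)"
    if "z < n" "y < n" "y \<noteq> z" for z y
    using arc_compatible_odd_idx[OF assms(1) that] .
  show "arc_complementary T (odd_idx n z y) (odd_idx n z' x)"
    if "x < n" "y < n" "z < n" "z' < n" "y \<noteq> z" "x \<noteq> z'" "mirror n z y = x" "mirror n z' x = y"
    for x y z z'
  proof -
    have "mirror n z' x = mirror n z x" using that mirror_mirror by auto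
    then have "z' = z" using mirror_inj_centre[OF assms(1)] that by blast
    then show ?thesis using arc_complementary_odd_idx[OF assms(1) that(3,2,5)] that by simp
  qed
qed

lemma frame_filling_even:
  assumes n: "odd n" "1 < n" and sub: "subsystem w r s f"
  shows "frame_filling w r s f (Suc n) (even_pred n) (\<lambda>z y. T (even_idx n z y))"
proof (rule frame_fillingI[OF sub])
  let ?u = "halfway n" and ?v = "\<lambda>z. succ n (halfway n z)"
  have u: "?u z < n" "?u z \<noteq> z" "?v z < n" "?v z \<noteq> z" "?v z \<noteq> ?u z"
    "mirror n z (?u z) = ?v z" "mirror n z (?v z) = ?u z" if "z < n" for z
  proof -
    show *: "?u z < n" "?u z \<noteq> z" "?v z < n" "?v z \<noteq> z" "mirror n z (?u z) = ?v z"
      using that n halfway_less halfway_neq succ_less succ_halfway_neq mirror_halfway by auto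
    show "?v z \<noteq> ?u z" using n by (auto simp: succ_def)
    show "mirror n z (?v z) = ?u z" using *(1,5) mirror_mirror[OF that, of "?u z"] by simp
  qed
  have m: "mirror n z y < n" "mirror n z y \<noteq> z" "mirror n z y \<noteq> y" "mirror n z (mirror n z y) = y"
    if "z < n" "y < n" "y \<noteq> z" for z y
    using that mirror_less mirror_eq_centre mirror_fixed n(1) mirror_mirror by metis+
  have mu: "mirror n z y = ?u z \<longleftrightarrow> y = ?v z" "mirror n z y = ?v z \<longleftrightarrow> y = ?u z"
    if "z < n" "y < n" for z y
    using that u[OF that(1)] mirror_inj[OF that] by metis+
  have v_inj: "z = z'" if "z < n" "z' < n" "?v z = ?v z'" for z z'
    using that halfway_inj halfway_less prev_succ by metis
  note [simp] = even_pred_def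
  show "even_pred n z y < Suc n \<and> even_pred n z y \<noteq> z \<and> even_pred n z y \<noteq> y"
    if "z < Suc n" "y < Suc n" "y \<noteq> z" for z y
  proof (cases "z = n")
    case True then show ?thesis using that prev_less[of y n] n by (auto simp: prev_def)
  next
    case False
    then have z: "z < n" using that by simp
    show ?thesis using that z u[OF z] m[OF z] by (cases "y = n") (auto simp: less_Suc_eq)
  qed
  show "y = y'"
    if "z < Suc n" "y < Suc n" "y \<noteq> z" "y' < Suc n" "y' \<noteq> z" "even_pred n z y = even_pred n z y'" for z y y'
  proof (cases "z = n")
    case True then show ?thesis using that by (auto simp: prev_def split: if_splits)
  next
    case False
    then have z: "z < n" using that by simp
    \<comment> \<open>An explicit inverse of the predecessor map of class \<open>z\<close>;
      injectivity follows by applying it to the common value.\<close>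
    have inverse: "t = (if even_pred n z t = n then ?v z
        else if even_pred n z t = ?u z then n else mirror n z (even_pred n z t))"
      if "t < Suc n" "t \<noteq> z" for t
    proof (cases "t = n \<or> t = ?v z")
      case True then show ?thesis using z u[OF z] by auto
    next
      case False
      then have t: "t < n" using that by simp
      then have "even_pred n z t = mirror n z t" using z False by simp
      then show ?thesis using m[OF z t that(2)] mu[OF z t] False by simp
    qed
    show ?thesis
      by (rule trans[OF inverse[OF that(2,3), unfolded that(6)] inverse[OF that(4,5), symmetric]])
  qed
  show "z = z'"
    if "y < Suc n" "z < Suc n" "y \<noteq> z" "z' < Suc n" "y \<noteq> z'" "even_pred n z y = even_pred n z' y" for y z z'
  proof (cases "y = n")
    case True
    then show ?thesis using that halfway_inj[of z n z'] by auto
  next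
    case False
    then have y: "y < n" using that by simp
    have p: "prev n y < n" using prev_less y by simp
    \<comment> \<open>Three sorts of predecessor with no value in common: that of the rotation, the
      extra layer, and an unchanged reflection. Within each sort the value determines the
      class.\<close>
    have val: "t = n \<and> even_pred n t y = prev n y \<or> t < n \<and> y = ?v t \<and> even_pred n t y = n \<or>
        t < n \<and> even_pred n t y = mirror n t y \<and> mirror n t y < n \<and> mirror n t y \<noteq> prev n y"
      if "t < Suc n" "y \<noteq> t" for t
    proof (cases "t = n \<or> y = ?v t")
      case True then show ?thesis using that y by auto
    next
      case False
      then have "t < n" using that by simp
      then show ?thesis using False y mirror_less[of t n y] mirror_eq_prev[OF n(1), of t y] by auto
    qed
    show ?thesis
      using val[OF that(2,3)] val[OF that(4,5)]
      that(6) p y v_inj[of z z'] mirror_inj_centre[OF n(1), of z z' y]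
      by (elim disjE conjE) (simp_all del: even_pred_def)
  qed
  show "arc_compatible T (even_idx n z (even_pred n z y)) (even_idx n z y)"
    if "z < Suc n" "y < Suc n" "y \<noteq> z" for z y
  proof (cases "z = n")
    case True
    then have y: "y < n" using that by simp
    have "(even_idx n z (even_pred n z y), even_idx n z y) \<in> {(4,5), (5,2), (2,3), (3,2), (2,4)}"
    proof -
      consider "y = 0" | "y = 1" | "y = n - 1" "1 < y" | "1 < y" "y < n - 1" using y n by linarith
      moreover have "2 < n" using n by (cases "n = 2") auto
      ultimately show ?thesis using True n by cases (auto simp: even_idx_def prev_def)
    qed
    then show ?thesis by (intro compatible) blast
  next
    case False
    then have z: "z < n" using that by simp
    consider "y = n" | "y = ?u z" | "y = ?v z" | "y < n" "y \<noteq> ?u z" "y \<noteq> ?v z"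
      using \<open>y < Suc n\<close> by linarith
    then show ?thesis
    proof cases
      case 1 then show ?thesis using z u[OF z] compatible[of 8 6] by (auto simp: even_idx_def)
    next
      case 2
      then have "even_idx n z y = 8" "even_idx n z (even_pred n z y) = 7"
        using z u[OF z] by (auto simp: even_idx_def)
      then show ?thesis using compatible[of 7 8] by simp
    next
      case 3
      then have "even_idx n z y = 7" "even_idx n z (even_pred n z y) = 6"
        using z u[OF z] by (auto simp: even_idx_def)
      then show ?thesis using compatible[of 6 7] by simp
    next
      case 4
      then show ?thesis
        using z u[OF z] m[OF z, of y] mu[OF z, of y] that arc_compatible_odd_idx[OF n(1) z, of y]
        by (auto simp: even_idx_def)
    qed
  qed
  \<comment> \<open>An arc into the extra layer has kind 6; its opposite has kind 7 and comes from
    the 3-cycle of another reflection.\<close>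
  have infinity: "arc_complementary T (even_idx n z y) (even_idx n z' x)"
    if "y = n" "x < Suc n" "z < Suc n" "z' < Suc n" "y \<noteq> z" "x \<noteq> z'" "even_pred n z y = x" "even_pred n z' x = y"
    for x y z z'
  proof -
    have z: "z < n" using that by auto
    then have x: "x = ?u z" "x < n" using that u by auto
    have "z' \<noteq> n" using that x prev_less[of x n] by auto
    then have z': "z' < n" using that by simp
    have "x = ?v z'" using that x z' m[of z' x] by (auto split: if_splits)
    then show ?thesis using complementary[of 6 7] that z z' x u[OF z'] by (auto simp: even_idx_def)
  qed
  \<comment> \<open>The opposite of a rotation arc is the arc of a 3-cycle that survived the
    rerouting, which is why kind 8 must complement each of the kinds 2 to 5.\<close>
  have rotation: "arc_complementary T (even_idx n z y) (even_idx n z' x)"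
    if "z = n" "x < n" "y < n" "z' < Suc n" "x \<noteq> z'" "even_pred n z y = x" "even_pred n z' x = y"
    for x y z z'
  proof -
    have x: "x = prev n y" using that by simp
    \<comment> \<open>On a cycle of length at least 3 the rotation cannot contain the opposite arc
      as well.\<close>
    have "2 < n" using n by (cases "n = 2") auto
    then have "z' \<noteq> n" using that x by (auto simp: prev_def split: if_splits)
    then have z': "z' < n" using that by simp
    have "mirror n z' x = y" using that z' by (auto split: if_splits)
    then have "mirror n z' y = prev n y" using mirror_mirror[OF z' that(2)] x by simp
    then have "y = ?v z'" using mirror_eq_prev[OF n(1) z' that(3)] by simp
    then have "x = ?u z'" using x prev_succ u[OF z'] by simp
    then have "even_idx n z' x = 8" using z' u[OF z'] by (auto simp: even_idx_def)
    moreover have "even_idx n z y \<in> {2,3,4,5}" using that by (auto simp: even_idx_def)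
    ultimately show ?thesis using complementary[of 8 "even_idx n z y"] arc_complementary_sym by simp
  qed
  show "arc_complementary T (even_idx n z y) (even_idx n z' x)"
    if "x < Suc n" "y < Suc n" "z < Suc n" "z' < Suc n" "y \<noteq> z" "x \<noteq> z'" "even_pred n z y = x" "even_pred n z' x = y"
    for x y z z'
  proof -
    consider "y = n" | "x = n" | "z = n" "x < n" "y < n" | "z' = n" "x < n" "y < n"
      | "x < n" "y < n" "z < n" "z' < n"
      using \<open>x < Suc n\<close> \<open>y < Suc n\<close> \<open>z < Suc n\<close> \<open>z' < Suc n\<close> by linarith
    then show ?thesis
    proof cases
      case 1 then show ?thesis using infinity that by blast
    next
      case 2 then show ?thesis using infinity[of x y z' z] that arc_complementary_sym by blast
    next
      case 3 then show ?thesis using rotation that by blast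
    next
      case 4 then show ?thesis using rotation[of z' y x z] that arc_complementary_sym by blast
    next
      case 5
      have y: "y \<noteq> ?v z" "mirror n z y = x" and x: "x \<noteq> ?v z'" "mirror n z' x = y"
        using that 5 by (auto split: if_splits)
      have "mirror n z' x = mirror n z x" using y x 5 mirror_mirror by auto
      then have zz: "z' = z" using mirror_inj_centre[OF n(1)] 5 by blast
      have "y \<noteq> ?u z" "x \<noteq> ?u z" using x y zz mu[OF 5(3), of y] mu[OF 5(3), of x] 5 by auto
      then show ?thesis
        using 5 x y zz that arc_complementary_odd_idx[OF n(1) 5(3) 5(2)] by (auto simp: even_idx_def)
    qed
  qed
qed

lemma exists_URD_subsystem:
  assumes "subsystem w r s f" and "3 \<le> N"
  shows "exists_K2_K13_URD (12 * N + w) r (8 * N + s)"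
proof (cases "odd N")
  case True
  then show ?thesis
    using frame_filling.exists_URD[OF frame_filling_odd[OF _ assms(1)]] assms(2) by auto
next
  case False
  then obtain n where n: "N = Suc n" "odd n" using assms(2) by (cases N) auto
  then show ?thesis
    using frame_filling.exists_URD[OF frame_filling_even[OF _ _ assms(1)], of n] assms(2) by auto
qed

end

text \<open>Supplies the case without layers: inside the hole only the splitting classes have edges,
  so they restrict to a decomposition of the hole.\<close>

lemma subsystem_restrict:
  assumes "subsystem w r s f" and "0 < w"
  shows "exists_K2_K13_URD w r s"
proof -
  interpret subsystem w r s f by fact
  define W where "W = {12..<12 + w}"
  have inside: "f i a \<in> W" if "i < r \<or> r + 8 \<le> i \<and> i < r + 8 + s" "a \<in> W" for i a
  proof -
    have "f i a < 12 + w"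
      using f_urd that unfolding urd_maps_def matching_map_def star_map_def W_def
      by (cases "i < r") auto
    then show ?thesis using f_preserves[OF that(1), of a] that(2) by (auto simp: W_def)
  qed
  have "urd_maps W {..<r} {r + 8..<r + 8 + s} f"
    unfolding urd_maps_def
  proof (intro conjI ballI impI)
    show "matching_map W (f i)" if "i \<in> {..<r}" for i
      using f_urd inside[of i] that by (auto simp: urd_maps_def matching_map_def W_def)
    show "star_map W (f i)" if i: "i \<in> {r + 8..<r + 8 + s}" for i
      unfolding star_map_def
    proof (intro conjI ballI impI)
      have st: "star_map {..<12 + w} (f i)" using f_urd i by (auto simp: urd_maps_def)
      show "f i x \<in> W" "f i (f i x) = f i x" if "x \<in> W" for x
        using inside[of i x] star_mapD[OF st, of x] i that by (auto simp: W_def)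
      show "card {x \<in> W. x \<noteq> c \<and> f i x = c} = 3" if c: "c \<in> W" "f i c = c" for c
      proof -
        have "x \<in> W" if "x < 12 + w" "f i x = c" for x
          using f_preserves[of i x] that c i by (auto simp: W_def)
        then have "{x \<in> W. x \<noteq> c \<and> f i x = c} = {x \<in> {..<12 + w}. x \<noteq> c \<and> f i x = c}"
          by (auto simp: W_def)
        then show ?thesis using star_map_leaves[OF st, of c] c by (simp add: W_def)
      qed
    qed
    fix x y assume xy: "x \<in> W" "y \<in> W" "x \<noteq> y"
    have ex: "\<exists>!i. i \<in> {..<r} \<union> {r..<r + 8 + s} \<and> (f i x = y \<or> f i y = x)"
      using f_urd xy by (auto simp: urd_maps_def W_def)
    have no: "\<not> (f i x = y \<or> f i y = x)" if "r \<le> i" "i < r + 8" for i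
      using f_hole[OF that, of x] f_hole[OF that, of y] xy by (auto simp: W_def)
    have "i \<in> {..<r} \<union> {r + 8..<r + 8 + s} \<and> (f i x = y \<or> f i y = x) \<longleftrightarrow>
        i \<in> {..<r} \<union> {r..<r + 8 + s} \<and> (f i x = y \<or> f i y = x)" for i
      using no[of i] by (cases "r \<le> i"; cases "i < r + 8") simp_all
    with ex show "\<exists>!i. i \<in> {..<r} \<union> {r + 8..<r + 8 + s} \<and> (f i x = y \<or> f i y = x)"
      by simp
  qed (auto simp: W_def)
  then show ?thesis
    using urd_maps_imp_exists[of W "{..<r}" "{r + 8..<r + 8 + s}" f] assms(2) by (simp add: W_def)
qed

section \<open>Checking tables\<close>

text \<open>The lists are the columns of the points \<open>x\<close> and \<open>y\<close>. Branching
  by \<open>if\<close> lets simplification decide the current row before it unfolds the recursive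
  call.\<close>

fun no_hit :: "nat \<Rightarrow> nat \<Rightarrow> nat list \<Rightarrow> nat list \<Rightarrow> bool" where
  "no_hit x y (a # as) (b # bs) \<longleftrightarrow>
     (if a = y then False else if b = x then False else no_hit x y as bs)"
| "no_hit x y _ _ \<longleftrightarrow> True"

fun one_hit :: "nat \<Rightarrow> nat \<Rightarrow> nat list \<Rightarrow> nat list \<Rightarrow> bool" where
  "one_hit x y (a # as) (b # bs) \<longleftrightarrow>
     (if a = y then no_hit x y as bs else if b = x then no_hit x y as bs else one_hit x y as bs)"
| "one_hit x y _ _ \<longleftrightarrow> False"

fun hits_from :: "nat \<Rightarrow> nat list \<Rightarrow> nat \<Rightarrow> nat list list \<Rightarrow> bool" where
  "hits_from x c y [] \<longleftrightarrow> True"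
| "hits_from x c y (d # ds) \<longleftrightarrow> (if one_hit x y c d then hits_from x c (Suc y) ds else False)"

fun all_hits :: "nat \<Rightarrow> nat list list \<Rightarrow> bool" where
  "all_hits x [] \<longleftrightarrow> True"
| "all_hits x (c # cs) \<longleftrightarrow> (if hits_from x c (Suc x) cs then all_hits (Suc x) cs else False)"

text \<open>Transposition; the first list only counts the columns.\<close>

fun columns :: "nat list \<Rightarrow> nat list list \<Rightarrow> nat list list" where
  "columns [] rows = []"
| "columns (_ # as) rows = map hd rows # columns as (map tl rows)"

fun fixed_points :: "nat \<Rightarrow> nat list \<Rightarrow> nat list" where
  "fixed_points x [] = []"
| "fixed_points x (a # as) = (if a = x then x # fixed_points (Suc x) as else fixed_points (Suc x) as)"

text \<open>In a star factor each centre is the value of four points, itself and its leaves, so the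
  sorted row repeats every fixed point four times.\<close>

fun quadruples :: "nat list \<Rightarrow> nat list" where
  "quadruples [] = []"
| "quadruples (c # cs) = c # c # c # c # quadruples cs"

fun involution_from :: "nat list \<Rightarrow> nat \<Rightarrow> nat list \<Rightarrow> bool" where
  "involution_from row x [] \<longleftrightarrow> True"
| "involution_from row x (a # as) \<longleftrightarrow>
     (if a \<noteq> x \<and> row ! a = x then involution_from row (Suc x) as else False)"

definition urd_table :: "nat \<Rightarrow> nat list list \<Rightarrow> nat list list \<Rightarrow> bool" where
  "urd_table v M S \<longleftrightarrow>
     (\<forall>row\<in>set (M @ S). length row = v \<and> (\<forall>a\<in>set row. a < v)) \<and>
     (\<forall>row\<in>set M. involution_from row 0 row) \<and>
     (\<forall>row\<in>set S. sort row = quadruples (fixed_points 0 row)) \<and>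
     all_hits 0 (columns (hd (M @ S)) (M @ S))"

section \<open>Correctness of the checks\<close>

lemma no_hit_iff:
  "length as = length bs \<Longrightarrow> no_hit x y as bs \<longleftrightarrow> (\<forall>i<length as. \<not> (as ! i = y \<or> bs ! i = x))"
  by (induction as bs rule: list_induct2) (auto simp: less_Suc_eq_0_disj)

lemma Ex1_less_Suc:
  "(\<exists>!i. i < Suc n \<and> P i) \<longleftrightarrow> (if P 0 then \<forall>i<n. \<not> P (Suc i) else \<exists>!i. i < n \<and> P (Suc i))"
proof (cases "P 0")
  case True
  then show ?thesis by (auto simp: less_Suc_eq_0_disj)
next
  case False
  have "(\<exists>!i. i < n \<and> P (Suc i)) \<longleftrightarrow> (\<exists>!i. i < Suc n \<and> P i)"
  proof
    assume "\<exists>!i. i < n \<and> P (Suc i)"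
    then obtain i where i: "i < n" "P (Suc i)" "\<And>j. j < n \<Longrightarrow> P (Suc j) \<Longrightarrow> j = i" by blast
    show "\<exists>!i. i < Suc n \<and> P i"
    proof (rule ex1I[of _ "Suc i"])
      show "j = Suc i" if j: "j < Suc n \<and> P j" for j
        using i(3)[of "j - 1"] j False by (cases j) auto
    qed (use i(1,2) in simp)
  next
    assume "\<exists>!i. i < Suc n \<and> P i"
    then obtain i where i: "i < Suc n" "P i" "\<And>j. j < Suc n \<Longrightarrow> P j \<Longrightarrow> j = i" by blast
    then obtain k where k: "i = Suc k" using False by (cases i) auto
    show "\<exists>!i. i < n \<and> P (Suc i)"
    proof (rule ex1I[of _ k])
      show "j = k" if "j < n \<and> P (Suc j)" for j
        using i(3)[of "Suc j"] that k by simp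
    qed (use i(1,2) k in simp)
  qed
  then show ?thesis using False by simp
qed

lemma one_hit_iff:
  "length as = length bs \<Longrightarrow> one_hit x y as bs \<longleftrightarrow> (\<exists>!i. i < length as \<and> (as ! i = y \<or> bs ! i = x))"
proof (induction as bs rule: list_induct2)
  case (Cons a as b bs)
  then show ?case by (auto simp: Ex1_less_Suc no_hit_iff)
qed (simp add: Ex1_def)

lemma one_hit_map:
  assumes "one_hit x y (map f xs) (map g xs)"
  shows "\<exists>!i. i < length xs \<and> (f (xs ! i) = y \<or> g (xs ! i) = x)"
  using one_hit_iff[of "map f xs" "map g xs" x y] assms by (simp cong: conj_cong)

lemma hits_from_nth: "hits_from x c y ds \<Longrightarrow> j < length ds \<Longrightarrow> one_hit x (y + j) c (ds ! j)"
  by (induction x c y ds arbitrary: j rule: hits_from.induct) (auto simp: less_Suc_eq_0_disj split: if_splits)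

lemma all_hits_nth:
  "all_hits x cs \<Longrightarrow> i < j \<Longrightarrow> j < length cs \<Longrightarrow> one_hit (x + i) (x + j) (cs ! i) (cs ! j)"
proof (induction x cs arbitrary: i j rule: all_hits.induct)
  case (2 x c cs)
  show ?case
  proof (cases i)
    case 0
    then show ?thesis using 2 hits_from_nth[of x c "Suc x" cs "j - 1"] by (auto split: if_splits simp: nth_Cons')
  next
    case (Suc k)
    then show ?thesis using 2(1)[of k "j - 1"] 2(2-) by (auto split: if_splits simp: nth_Cons')
  qed
qed simp

lemma length_columns [simp]: "length (columns as rows) = length as"
  by (induction as rows rule: columns.induct) auto

lemma columns_nth:
  "\<lbrakk>\<forall>row\<in>set rows. length row = length as; x < length as\<rbrakk> \<Longrightarrow>
    columns as rows ! x = map (\<lambda>row. row ! x) rows"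
proof (induction as rows arbitrary: x rule: columns.induct)
  case (2 a as rows)
  have ne: "row \<noteq> []" if "row \<in> set rows" for row using 2(2) that by auto
  show ?case
  proof (cases x)
    case 0 then show ?thesis using ne by (auto simp: hd_conv_nth)
  next
    case (Suc k)
    then show ?thesis using 2 ne by (auto simp: nth_tl)
  qed
qed simp

lemma set_fixed_points:
  "y \<in> set (fixed_points x as) \<longleftrightarrow> x \<le> y \<and> y - x < length as \<and> as ! (y - x) = y"
proof (induction x as rule: fixed_points.induct)
  case (2 x a as)
  consider "y < x" | "y = x" | k where "y = Suc x + k"
    by (metis less_imp_Suc_add linorder_neqE_nat add_Suc)
  then show ?case
    by cases (use 2 in \<open>auto simp: nth_Cons'\<close>)
qed simp

lemma distinct_fixed_points: "distinct (fixed_points x as)"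
  by (induction x as rule: fixed_points.induct) (auto simp: set_fixed_points)

lemma count_quadruples: "distinct cs \<Longrightarrow> count_list (quadruples cs) x = (if x \<in> set cs then 4 else 0)"
  by (induction cs) auto

lemma count_list_eq_card: "count_list row x = card {i. i < length row \<and> row ! i = x}"
  by (simp add: count_list_eq_length_filter length_filter_conv_card eq_commute)

text \<open>Sorting preserves multiplicities, so a value occurs four times if it is a fixed point
  and never otherwise. Every value taken is therefore a fixed point, and discarding the centre
  leaves three leaves.\<close>

lemma star_map_nth:
  assumes len: "length row = v" and bound: "\<forall>a\<in>set row. a < v"
    and sort: "sort row = quadruples (fixed_points 0 row)"
  shows "star_map {..<v} ((!) row)"
proof -
  have count: "count_list row x = (if x < v \<and> row ! x = x then 4 else 0)" for x
  proof -
    have "count_list row x = count_list (sort row) x"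
      by (metis count_mset mset_sort)
    then show ?thesis using len
      by (simp add: sort count_quadruples distinct_fixed_points set_fixed_points)
  qed
  have card: "card {i \<in> {..<v}. row ! i = x} = count_list row x" for x
    using len by (simp add: count_list_eq_card)
  show ?thesis
    unfolding star_map_def
  proof (intro conjI ballI impI)
    fix x assume x: "x \<in> {..<v}"
    then have "row ! x \<in> set row" using len by simp
    then have "count_list row (row ! x) \<noteq> 0" by (simp add: count_list_0_iff)
    then show "row ! (row ! x) = row ! x" using count[of "row ! x"] by (auto split: if_splits)
    show "row ! x \<in> {..<v}" using bound \<open>row ! x \<in> set row\<close> by simp
  next
    fix c assume c: "c \<in> {..<v}" "row ! c = c"
    have "{x \<in> {..<v}. x \<noteq> c \<and> row ! x = c} = {i \<in> {..<v}. row ! i = c} - {c}" by auto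
    also have "card \<dots> = 3" using c card[of c] count[of c] by (subst card_Diff_singleton) auto
    finally show "card {x \<in> {..<v}. x \<noteq> c \<and> row ! x = c} = 3" .
  qed
qed

lemma involution_from_nth:
  "involution_from row x as \<Longrightarrow> i < length as \<Longrightarrow> as ! i \<noteq> x + i \<and> row ! (as ! i) = x + i"
  by (induction row x as arbitrary: i rule: involution_from.induct)
    (auto simp: less_Suc_eq_0_disj split: if_splits)

lemma urd_maps_table:
  assumes "urd_table v M S" and "M \<noteq> []"
  shows "urd_maps {..<v} {..<length M} {length M..<length M + length S} (\<lambda>i x. (M @ S) ! i ! x)"
  unfolding urd_maps_def
proof (intro conjI ballI impI)
  let ?R = "M @ S"
  have row: "length row = v" "\<forall>a\<in>set row. a < v" if "row \<in> set ?R" for row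
    using assms that unfolding urd_table_def by blast+
  show "matching_map {..<v} ((!) (?R ! i))" if "i \<in> {..<length M}" for i
  proof -
    have i: "?R ! i = M ! i" "M ! i \<in> set M" using that by (auto simp: nth_append)
    then have "involution_from (M ! i) 0 (M ! i)" using assms by (auto simp: urd_table_def)
    from involution_from_nth[OF this] show ?thesis
      unfolding i matching_map_def using row[of "M ! i"] i(2) by auto
  qed
  show "star_map {..<v} ((!) (?R ! i))" if "i \<in> {length M..<length M + length S}" for i
  proof -
    have i: "?R ! i = S ! (i - length M)" "S ! (i - length M) \<in> set S" using that by (auto simp: nth_append)
    then show ?thesis
      unfolding i(1) using assms row[of "S ! (i - length M)"]
      by (intro star_map_nth) (auto simp: urd_table_def)
  qed
  fix x y assume xy: "x \<in> {..<v}" "y \<in> {..<v}" "x \<noteq> y"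
  \<comment> \<open>The table check runs over pairs with \<open>x < y\<close>; the condition is
    symmetric in the two points.\<close>
  have *: "\<exists>!i. i < length ?R \<and> (?R ! i ! x = y \<or> ?R ! i ! y = x)" if "x < y" "y < v" for x y
  proof -
    have "hd ?R \<in> set ?R" using assms(2) by simp
    then have len: "length (hd ?R) = v" using row by blast
    have col: "columns (hd ?R) ?R ! x = map (\<lambda>row. row ! x) ?R" if "x < v" for x
      using columns_nth[of ?R "hd ?R" x] row len that by simp
    have "one_hit x y (columns (hd ?R) ?R ! x) (columns (hd ?R) ?R ! y)"
      using all_hits_nth[of 0 "columns (hd ?R) ?R" x y] assms that len by (simp add: urd_table_def)
    then show ?thesis using that col[of x] col[of y] by (intro one_hit_map) simp
  qed
  have "\<exists>!i. i < length ?R \<and> (?R ! i ! x = y \<or> ?R ! i ! y = x)"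
    using *[of x y] *[of y x] xy by (cases "x < y") (simp_all add: disj_commute)
  moreover have "{..<length M} \<union> {length M..<length M + length S} = {..<length ?R}" by auto
  ultimately show "\<exists>!i. i \<in> {..<length M} \<union> {length M..<length M + length S} \<and>
      (?R ! i ! x = y \<or> ?R ! i ! y = x)" by simp
qed auto


lemma exists_URD_table:
  assumes "urd_table v M S" and "length M = r" "0 < r" and "length S = s" and "0 < v"
  shows "exists_K2_K13_URD v r s"
proof -
  have "M \<noteq> []" "{..<v} \<noteq> {}" using assms by auto
  with urd_maps_imp_exists[OF urd_maps_table[OF assms(1)]] show ?thesis
    using assms(2,4) by simp
qed

definition preserves_hole :: "nat list \<Rightarrow> bool" where
  "preserves_hole row \<longleftrightarrow> (\<forall>a\<in>set (take 12 row). a < 12) \<and> (\<forall>a\<in>set (drop 12 row). 12 \<le> a)"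

fun fixed_or_outside :: "nat \<Rightarrow> nat list \<Rightarrow> bool" where
  "fixed_or_outside x [] \<longleftrightarrow> True"
| "fixed_or_outside x (a # as) \<longleftrightarrow> (a = x \<or> a < 12) \<and> fixed_or_outside (Suc x) as"

lemma fixed_or_outside_nth:
  "fixed_or_outside x as \<Longrightarrow> i < length as \<Longrightarrow> as ! i = x + i \<or> as ! i < 12"
proof (induction x as arbitrary: i rule: fixed_or_outside.induct)
  case (2 x a as)
  then show ?case using 2(1)[of "i - 1"] by (cases i) auto
qed simp

lemma preserves_hole_nth:
  assumes "preserves_hole row" "a < length row"
  shows "row ! a < 12 \<longleftrightarrow> a < 12"
proof (cases "a < 12")
  case True
  then have "row ! a \<in> set (take 12 row)" using assms(2) by (auto simp: in_set_conv_nth intro!: exI[of _ a])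
  then show ?thesis using assms(1) True by (auto simp: preserves_hole_def)
next
  case False
  then have "row ! a \<in> set (drop 12 row)"
    using assms(2) by (auto simp: in_set_conv_nth intro!: exI[of _ "a - 12"])
  then show ?thesis using assms(1) False by (auto simp: preserves_hole_def)
qed

text \<open>Convention for the tables: the first eight star rows are the classes without edges
  inside the hole, the later ones split along it.\<close>

lemma subsystem_table:
  assumes t: "urd_table (12 + w) M S" and r: "length M = r" "0 < r" and S: "length S = 8 + s"
    and pres: "\<forall>row\<in>set (M @ drop 8 S). preserves_hole row"
    and hole: "\<forall>row\<in>set (take 8 S). fixed_or_outside 12 (drop 12 row)"
  shows "subsystem w r s (\<lambda>i x. (M @ S) ! i ! x)"
  unfolding r(1)[symmetric]
proof
  have M: "M \<noteq> []" using r by auto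
  show "urd_maps {..<12 + w} {..<length M} {length M..<length M + 8 + s} (\<lambda>i x. (M @ S) ! i ! x)"
    using urd_maps_table[OF t M] S by (simp add: add.assoc)
  have len: "length row = 12 + w" if "row \<in> set (M @ S)" for row
    using t that unfolding urd_table_def by blast
  show "(M @ S) ! i ! a < 12 \<longleftrightarrow> a < 12"
    if "i < length M \<or> length M + 8 \<le> i \<and> i < length M + 8 + s" "a < 12 + w" for i a
  proof -
    have "(M @ S) ! i \<in> set (M @ drop 8 S)"
    proof (cases "i < length M")
      case True then show ?thesis by (simp add: nth_append)
    next
      case False
      then have "(M @ S) ! i = drop 8 S ! (i - length M - 8)" using that S by (simp add: nth_append)
      moreover have "drop 8 S ! (i - length M - 8) \<in> set (drop 8 S)"
        using that False S by (intro nth_mem) auto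
      ultimately show ?thesis by simp
    qed
    moreover have "(M @ S) ! i \<in> set (M @ S)" using that S by (intro nth_mem) auto
    ultimately show ?thesis using pres len that(2) by (intro preserves_hole_nth) simp_all
  qed
  show "(M @ S) ! i ! a = a \<or> (M @ S) ! i ! a < 12"
    if "length M \<le> i" "i < length M + 8" "12 \<le> a" "a < 12 + w" for i a
  proof -
    have "(M @ S) ! i = take 8 S ! (i - length M)" using that S by (simp add: nth_append)
    moreover have "take 8 S ! (i - length M) \<in> set (take 8 S)" using that S by (intro nth_mem) simp
    ultimately have h: "fixed_or_outside 12 (drop 12 ((M @ S) ! i))" using hole by simp
    have "(M @ S) ! i \<in> set (M @ S)" using that S by (intro nth_mem) simp
    then show ?thesis using fixed_or_outside_nth[OF h, of "a - 12"] that len by simp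
  qed
qed

section \<open>Checks for the arc tables\<close>

fun counts_from :: "nat list \<Rightarrow> nat \<Rightarrow> nat list \<Rightarrow> bool" where
  "counts_from u a [] \<longleftrightarrow> True"
| "counts_from u a (p # ps) \<longleftrightarrow>
     (if count_list u a = (if p = 12 then 3 else 0) then counts_from u (Suc a) ps else False)"

definition compatible_tables :: "nat list list \<Rightarrow> nat list list \<Rightarrow> bool" where
  "compatible_tables T U \<longleftrightarrow> length T = 8 \<and> length U = 8 \<and>
     (\<forall>(t, u)\<in>set (zip T U). length t = 12 \<and> length u = 12 \<and> (\<forall>a\<in>set u. a \<le> 12) \<and> counts_from u 0 t)"

definition complementary_tables :: "nat list list \<Rightarrow> nat list list \<Rightarrow> bool" where
  "complementary_tables T U \<longleftrightarrow> length T = 8 \<and> length U = 8 \<and>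
     (\<forall>t\<in>set (T @ U). length t = 12) \<and>
     (\<forall>(a, d)\<in>set (List.enumerate 0 (columns (hd U) U)). \<forall>(b, c)\<in>set (List.enumerate 0 (columns (hd T) T)).
        count_list c a + count_list d b = 1)"

lemma counts_from_nth:
  "counts_from u x ps \<Longrightarrow> i < length ps \<Longrightarrow> count_list u (x + i) = (if ps ! i = 12 then 3 else 0)"
proof (induction u x ps arbitrary: i rule: counts_from.induct)
  case (2 u a p ps)
  then show ?case using 2(1)[of "i - 1"] by (cases i) (auto split: if_splits)
qed simp

lemma arc_compatible_tables:
  assumes "compatible_tables (A ! i) (A ! j)"
  shows "arc_compatible (\<lambda>i k a. A ! i ! k ! a) i j"
  unfolding arc_compatible_def
proof (intro allI impI)
  fix k a :: nat assume k: "k < 8" and a: "a < 12"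
  have "(A ! i ! k, A ! j ! k) \<in> set (zip (A ! i) (A ! j))"
    using assms k by (auto simp: compatible_tables_def in_set_zip)
  then have c: "length (A ! i ! k) = 12" "length (A ! j ! k) = 12" "\<forall>a\<in>set (A ! j ! k). a \<le> 12"
    "counts_from (A ! j ! k) 0 (A ! i ! k)"
    using assms by (auto simp: compatible_tables_def)
  then have "A ! j ! k ! a \<le> 12" using a by simp
  then show "A ! j ! k ! a \<le> 12 \<and>
      card {b. b < 12 \<and> A ! j ! k ! b = a} = (if A ! i ! k ! a = 12 then 3 else 0)"
    using counts_from_nth[OF c(4), of a] c a by (simp add: count_list_eq_card)
qed

lemma arc_complementary_tables:
  assumes "complementary_tables (A ! i) (A ! j)"
  shows "arc_complementary (\<lambda>i k a. A ! i ! k ! a) i j"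
  unfolding arc_complementary_def
proof (intro allI impI)
  fix a b :: nat assume a: "a < 12" and b: "b < 12"
  have len: "length (A ! i) = 8" "length (A ! j) = 8" "\<forall>t\<in>set (A ! i). length t = 12"
    "\<forall>t\<in>set (A ! j). length t = 12"
    using assms by (auto simp: complementary_tables_def)
  then have hd: "length (hd (A ! i)) = 12" "length (hd (A ! j)) = 12" by (metis hd_in_set list.size(3) zero_neq_numeral)+
  have "(a, columns (hd (A ! j)) (A ! j) ! a) \<in> set (List.enumerate 0 (columns (hd (A ! j)) (A ! j)))"
    "(b, columns (hd (A ! i)) (A ! i) ! b) \<in> set (List.enumerate 0 (columns (hd (A ! i)) (A ! i)))"
    using a b hd by (auto simp: in_set_enumerate_eq)
  then have "count_list (columns (hd (A ! i)) (A ! i) ! b) a +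
      count_list (columns (hd (A ! j)) (A ! j) ! a) b = 1"
    using assms unfolding complementary_tables_def by blast
  then show "card {k. k < 8 \<and> A ! i ! k ! b = a} + card {k. k < 8 \<and> A ! j ! k ! a = b} = 1"
    using len hd a b by (simp add: columns_nth count_list_eq_card cong: conj_cong)
qed

section \<open>Tables\<close>

text \<open>The matchings use up the edges inside four groups of four consecutive points, the last
  group being the hole. The star rows form two orbits of length four under the simultaneous rotation
  of all groups.\<close>

definition matchings_16 :: "nat list list" where
  "matchings_16 =
    [[1,0,3,2,5,4,7,6,9,8,11,10,13,12,15,14],
     [2,3,0,1,6,7,4,5,10,11,8,9,14,15,12,13],
     [3,2,1,0,7,6,5,4,11,10,9,8,15,14,13,12]]"

definition stars_16 :: "nat list list" where
  "stars_16 =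
    [[13,1,13,13,14,14,14,11,1,1,1,11,11,13,14,11],
     [14,14,2,14,8,15,15,15,8,2,2,2,8,8,14,15],
     [15,15,15,3,12,9,12,12,3,9,3,3,12,9,9,15],
     [0,12,12,12,13,13,10,13,0,0,10,0,12,13,10,10],
     [0,6,8,5,0,5,6,0,8,6,5,5,0,6,8,8],
     [6,1,7,9,1,1,6,7,6,9,7,6,9,1,7,9],
     [10,7,2,4,4,2,2,7,7,7,10,4,10,10,2,4],
     [5,11,4,3,4,5,3,3,5,4,4,11,5,11,11,3]]"

lemma urd_table_16: "urd_table (12 + 4) matchings_16 stars_16"
  by (simp add: urd_table_def matchings_16_def stars_16_def)

lemma subsystem_16: "subsystem 4 3 0 (\<lambda>i x. (matchings_16 @ stars_16) ! i ! x)"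
  by (rule subsystem_table[OF urd_table_16])
    (simp_all add: matchings_16_def stars_16_def preserves_hole_def)

definition matchings_20 :: "nat list list" where
  "matchings_20 =
    [[1,0,3,2,5,4,7,6,9,8,11,10,16,17,18,19,12,13,14,15]]"

definition stars_20 :: "nat list list" where
  "stars_20 =
    [[12,12,4,12,4,19,19,14,8,19,14,14,12,8,14,8,8,4,4,19],
     [4,19,9,3,4,3,3,8,8,9,19,19,8,4,9,3,4,8,9,19],
     [17,15,2,17,7,17,15,7,10,10,10,15,2,2,2,15,10,17,7,7],
     [14,9,2,7,14,18,14,7,18,9,18,9,7,7,14,2,9,2,18,2],
     [16,1,11,3,3,16,16,15,11,15,15,11,11,1,3,15,16,1,1,3],
     [11,11,6,13,8,5,6,5,8,13,13,11,5,13,8,5,11,6,6,8],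
     [13,1,18,18,4,13,13,17,1,17,17,18,4,13,1,4,1,17,18,4],
     [0,5,16,16,11,5,12,16,5,12,12,11,12,11,5,0,16,11,0,0],
     [0,1,1,0,1,5,5,1,0,5,0,5,12,12,12,12,16,16,16,16],
     [2,6,2,9,9,2,6,9,2,9,6,6,17,13,13,13,13,17,17,17],
     [0,3,10,3,10,0,0,10,3,0,10,3,18,18,14,14,14,14,18,18],
     [7,10,7,10,6,10,6,7,6,6,10,7,19,19,19,15,15,15,15,19]]"

lemma urd_table_20: "urd_table (12 + 8) matchings_20 stars_20"
  by (simp add: urd_table_def matchings_20_def stars_20_def)

lemma subsystem_20: "subsystem 8 1 4 (\<lambda>i x. (matchings_20 @ stars_20) ! i ! x)"
  by (rule subsystem_table[OF urd_table_20])
    (simp_all add: matchings_20_def stars_20_def preserves_hole_def)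

text \<open>Both halves carry the same URD(12; 5, 4), shifted by 12, which exhausts their inner
  edges. The eight remaining star rows decompose the complete bipartite graph between the halves (8
  * 18 = 144 edges).\<close>

definition matchings_24 :: "nat list list" where
  "matchings_24 =
    [[4,2,1,7,0,6,5,3,10,11,8,9,16,14,13,19,12,18,17,15,22,23,20,21],
     [8,3,6,1,5,4,2,11,0,10,9,7,20,15,18,13,17,16,14,23,12,22,21,19],
     [1,0,3,2,8,9,7,6,4,5,11,10,13,12,15,14,20,21,19,18,16,17,23,22],
     [2,5,0,11,7,1,10,4,9,8,6,3,14,17,12,23,19,13,22,16,21,20,18,15],
     [3,9,10,0,6,7,4,5,11,1,2,8,15,21,22,12,18,19,16,17,23,13,14,20]]"

definition stars_24 :: "nat list list" where
  "stars_24 =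
    [[0,13,22,13,22,20,22,7,13,9,20,20,9,13,7,7,7,0,0,9,20,9,22,0],
     [14,1,14,23,4,23,21,23,21,14,10,21,4,10,14,4,10,4,1,1,1,21,10,23],
     [20,15,2,15,20,5,20,22,22,22,15,11,5,5,11,15,2,11,5,2,20,2,22,11],
     [12,21,12,3,23,21,6,21,8,23,23,12,12,6,6,8,3,3,8,6,8,21,3,23],
     [13,17,17,3,13,5,18,17,8,18,18,13,8,13,3,5,5,17,18,8,3,3,5,8],
     [0,14,18,18,18,14,6,19,14,9,19,19,6,9,14,0,9,6,18,19,9,0,0,6],
     [19,1,15,19,16,19,15,7,16,15,10,16,1,7,10,15,16,10,7,19,7,10,1,1],
     [16,16,2,12,4,17,16,12,17,17,12,11,12,2,4,11,16,17,11,4,2,4,11,2],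
     [7,7,7,3,11,11,11,7,3,3,3,11,19,19,19,15,23,23,23,19,15,15,15,23],
     [0,4,4,4,4,8,8,8,8,0,0,0,12,16,16,16,16,20,20,20,20,12,12,12],
     [5,1,5,5,9,5,9,9,1,9,1,1,17,13,17,17,21,17,21,21,13,21,13,13],
     [6,6,2,6,10,10,6,10,2,2,10,2,18,18,14,18,22,22,18,22,14,14,22,14]]"

lemma urd_table_24: "urd_table (12 + 12) matchings_24 stars_24"
  by (simp add: urd_table_def matchings_24_def stars_24_def)

lemma subsystem_24: "subsystem 12 5 4 (\<lambda>i x. (matchings_24 @ stars_24) ! i ! x)"
  by (rule subsystem_table[OF urd_table_24])
    (simp_all add: matchings_24_def stars_24_def preserves_hole_def)

lemma exists_URD_16: "exists_K2_K13_URD (12 + 4) 3 8"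
  by (rule exists_URD_table[OF urd_table_16]) (simp_all add: matchings_16_def stars_16_def)

lemma exists_URD_20: "exists_K2_K13_URD (12 + 8) 1 12"
  by (rule exists_URD_table[OF urd_table_20]) (simp_all add: matchings_20_def stars_20_def)

lemma exists_URD_24: "exists_K2_K13_URD (12 + 12) 5 12"
  by (rule exists_URD_table[OF urd_table_24]) (simp_all add: matchings_24_def stars_24_def)

text \<open>Two layers with \<open>w = 4\<close>: groups of four as for 16 points, and star rows in
  four orbits under the rotation of all groups.\<close>

definition matchings_28 :: "nat list list" where
  "matchings_28 =
    [[1,0,3,2,5,4,7,6,9,8,11,10,13,12,15,14,17,16,19,18,21,20,23,22,25,24,27,26],
     [2,3,0,1,6,7,4,5,10,11,8,9,14,15,12,13,18,19,16,17,22,23,20,21,26,27,24,25],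
     [3,2,1,0,7,6,5,4,11,10,9,8,15,14,13,12,19,18,17,16,23,22,21,20,27,26,25,24]]"

definition stars_28 :: "nat list list" where
  "stars_28 =
    [[8,1,8,8,4,1,1,9,8,9,27,27,1,4,26,15,15,4,27,9,26,4,9,26,15,15,26,27],
     [9,9,2,9,10,5,2,2,24,9,10,24,12,2,5,27,10,12,5,24,27,27,5,10,24,12,12,27],
     [10,10,10,3,3,11,6,3,25,25,10,11,24,13,3,6,25,11,13,6,11,24,24,6,24,25,13,13],
     [0,11,11,11,0,0,8,7,8,26,26,11,7,25,14,0,7,26,8,14,7,8,25,25,14,25,26,14],
     [20,20,2,27,4,21,10,7,7,27,10,4,20,10,21,21,2,10,7,2,20,21,7,27,2,4,4,27],
     [24,21,21,3,4,5,22,11,5,4,24,11,22,21,11,22,3,3,11,4,24,21,22,4,24,3,5,5],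
     [0,25,22,22,8,5,6,23,8,6,5,25,23,23,22,8,5,0,0,8,5,25,22,23,6,25,0,6],
     [23,1,26,23,20,9,6,7,26,9,7,6,9,20,20,23,9,6,1,1,20,6,26,23,7,7,26,1],
     [21,1,17,6,14,17,6,14,22,21,21,11,11,11,14,1,11,17,14,22,6,21,22,1,1,17,6,22],
     [7,22,2,18,15,15,18,7,8,23,22,22,2,8,8,15,23,8,18,15,2,7,22,23,23,2,18,7],
     [19,4,23,3,4,12,12,19,23,9,20,23,12,3,9,9,12,20,9,19,20,3,4,23,4,20,3,19],
     [0,16,5,20,16,5,13,13,20,20,10,21,10,13,0,10,16,13,21,10,20,21,0,5,16,5,21,0],
     [25,1,18,15,18,13,25,1,1,17,25,15,18,13,1,15,13,17,18,19,19,19,13,19,17,25,15,17],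
     [12,26,2,19,2,19,14,26,12,2,18,26,12,19,14,2,16,14,18,19,16,16,16,14,18,18,26,12],
     [16,13,27,3,27,3,16,15,27,13,3,19,3,13,16,15,16,17,15,19,15,17,17,17,13,19,19,27],
     [0,17,14,24,12,24,0,17,16,24,14,0,12,0,14,17,16,17,18,12,18,12,18,18,24,14,16,16]]"

lemma urd_table_28: "urd_table 28 matchings_28 stars_28"
  by (simp add: urd_table_def matchings_28_def stars_28_def)

lemma exists_URD_28: "exists_K2_K13_URD 28 3 16"
  by (rule exists_URD_table[OF urd_table_28]) (simp_all add: matchings_28_def stars_28_def)

text \<open>The matching and the first four star rows place the URD(8; 1, 4) that
  \<open>stars_20\<close> has at infinity on each block of eight points; the other 16 rows decompose
  the edges between blocks (16 * 24 = 6 * 64).\<close>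

definition matchings_32 :: "nat list list" where
  "matchings_32 =
    [[4,5,6,7,0,1,2,3,12,13,14,15,8,9,10,11,20,21,22,23,16,17,18,19,28,29,30,31,24,25,26,27]]"

definition stars_32 :: "nat list list" where
  "stars_32 =
    [[0,0,0,0,4,4,4,4,8,8,8,8,12,12,12,12,16,16,16,16,20,20,20,20,24,24,24,24,28,28,28,28],
     [5,1,1,1,1,5,5,5,13,9,9,9,9,13,13,13,21,17,17,17,17,21,21,21,29,25,25,25,25,29,29,29],
     [6,6,2,2,2,2,6,6,14,14,10,10,10,10,14,14,22,22,18,18,18,18,22,22,30,30,26,26,26,26,30,30],
     [7,7,7,3,3,3,3,7,15,15,15,11,11,11,11,15,23,23,23,19,19,19,19,23,31,31,31,27,27,27,27,31],
     [27,21,27,3,11,18,27,7,24,24,17,11,21,7,18,17,24,17,18,11,3,21,3,7,24,7,3,27,17,11,21,18],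
     [0,28,22,28,4,12,19,28,18,25,25,18,12,22,0,19,0,25,18,19,12,4,22,4,19,25,0,4,28,18,12,22],
     [29,1,29,23,29,5,13,20,20,19,26,26,19,13,23,1,5,1,26,19,20,13,5,23,23,20,26,1,5,29,19,13],
     [21,30,2,30,16,30,6,14,2,21,20,27,27,20,14,16,16,6,2,27,20,21,14,6,14,16,21,27,2,6,30,20],
     [15,22,31,3,31,17,31,7,17,3,22,21,28,28,21,15,7,17,7,3,28,21,22,15,21,15,17,22,28,3,7,31],
     [0,8,23,24,4,24,18,24,8,18,4,23,22,29,29,22,8,0,18,0,4,29,22,23,24,22,8,18,23,29,4,0],
     [25,1,9,16,25,5,25,19,23,9,19,5,16,23,30,30,16,9,1,19,1,5,30,23,1,25,23,9,19,16,30,5],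
     [20,26,2,10,17,26,6,26,31,16,10,20,6,17,16,31,16,17,10,2,20,2,6,31,6,2,26,16,10,20,17,31],
     [23,23,2,25,13,23,14,7,25,9,7,7,2,13,14,2,13,31,25,31,14,31,9,23,13,25,2,7,14,9,9,31],
     [0,16,16,3,26,14,16,15,3,26,10,0,0,3,14,15,16,14,24,26,24,15,24,10,24,14,26,3,0,15,10,10],
     [8,1,17,17,4,27,15,17,8,4,27,11,1,1,4,15,11,17,15,25,27,25,8,25,11,25,15,27,4,1,8,11],
     [18,9,2,18,18,5,28,8,8,9,5,28,12,2,2,5,26,12,18,8,26,28,26,9,12,12,26,8,28,5,2,9],
     [9,19,10,3,19,19,6,29,6,9,10,6,29,13,3,3,10,27,13,19,9,27,29,27,10,13,13,27,9,29,6,3],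
     [30,10,20,11,4,20,20,7,4,7,10,11,7,30,14,4,28,11,28,14,20,10,28,30,4,11,14,14,28,10,30,7],
     [0,31,11,21,12,5,21,21,5,5,0,11,12,0,31,15,31,29,12,29,15,21,11,29,0,5,12,15,15,29,11,31],
     [22,1,24,12,22,13,6,22,8,6,6,1,12,13,1,24,30,24,30,13,30,8,22,12,24,1,6,13,8,8,30,12]]"

lemma urd_table_32: "urd_table 32 matchings_32 stars_32"
  by (simp add: urd_table_def matchings_32_def stars_32_def)

lemma exists_URD_32: "exists_K2_K13_URD 32 1 20"
  by (rule exists_URD_table[OF urd_table_32]) (simp_all add: matchings_32_def stars_32_def)

text \<open>Three shifted copies of the URD(12; 5, 4) in the halves for 24 points; the last 16 star
  rows decompose the complete tripartite graph between them (16 * 27 = 3 * 144).\<close>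

definition matchings_36 :: "nat list list" where
  "matchings_36 =
    [[4,2,1,7,0,6,5,3,10,11,8,9,16,14,13,19,12,18,17,15,22,23,20,21,28,26,25,31,24,30,29,27,34,35,32,33],
     [8,3,6,1,5,4,2,11,0,10,9,7,20,15,18,13,17,16,14,23,12,22,21,19,32,27,30,25,29,28,26,35,24,34,33,31],
     [1,0,3,2,8,9,7,6,4,5,11,10,13,12,15,14,20,21,19,18,16,17,23,22,25,24,27,26,32,33,31,30,28,29,35,34],
     [2,5,0,11,7,1,10,4,9,8,6,3,14,17,12,23,19,13,22,16,21,20,18,15,26,29,24,35,31,25,34,28,33,32,30,27],
     [3,9,10,0,6,7,4,5,11,1,2,8,15,21,22,12,18,19,16,17,23,13,14,20,27,33,34,24,30,31,28,29,35,25,26,32]]"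

definition stars_36 :: "nat list list" where
  "stars_36 =
    [[7,7,7,3,11,11,11,7,3,3,3,11,19,19,19,15,23,23,23,19,15,15,15,23,31,31,31,27,35,35,35,31,27,27,27,35],
     [0,4,4,4,4,8,8,8,8,0,0,0,12,16,16,16,16,20,20,20,20,12,12,12,24,28,28,28,28,32,32,32,32,24,24,24],
     [5,1,5,5,9,5,9,9,1,9,1,1,17,13,17,17,21,17,21,21,13,21,13,13,29,25,29,29,33,29,33,33,25,33,25,25],
     [6,6,2,6,10,10,6,10,2,2,10,2,18,18,14,18,22,22,18,22,14,14,22,14,30,30,26,30,34,34,30,34,26,26,34,26],
     [12,18,2,3,15,5,12,15,15,17,10,11,12,3,10,15,2,17,18,5,3,3,2,11,18,11,18,12,17,10,2,5,5,11,17,10],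
     [0,13,19,3,12,12,6,13,8,12,18,11,12,13,0,11,6,3,18,19,8,0,0,3,13,19,8,19,6,18,11,3,11,6,8,18],
     [0,1,14,16,14,13,13,7,8,9,13,19,8,13,14,1,16,7,0,19,0,9,1,1,16,14,16,9,0,7,19,8,19,8,7,9],
     [17,1,2,15,4,15,14,14,16,9,10,14,2,9,14,15,16,17,4,1,2,1,10,2,10,17,15,17,9,1,4,16,10,16,9,4],
     [15,25,15,25,24,17,34,21,17,22,10,27,24,27,27,15,10,17,25,34,24,21,22,34,24,25,21,27,22,21,17,10,22,10,34,15],
     [26,12,26,12,22,25,18,35,24,18,23,11,12,25,24,24,35,11,18,26,35,25,22,23,24,25,26,22,11,23,22,18,12,23,11,35],
     [13,27,13,27,32,23,26,19,8,25,19,20,25,13,26,25,27,32,8,19,20,32,26,23,23,25,26,27,19,8,20,23,32,13,20,8],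
     [24,14,24,14,16,33,20,27,21,9,26,16,26,26,14,27,16,24,33,9,20,21,33,27,24,20,26,27,20,16,9,21,9,33,14,21],
     [30,1,29,3,4,5,31,32,32,31,30,11,11,29,29,32,5,31,3,3,5,5,11,30,1,4,11,4,3,29,30,31,32,1,4,1],
     [0,31,2,30,33,5,6,28,8,33,28,31,33,8,30,30,0,6,28,0,31,6,6,8,5,2,5,8,28,0,30,31,2,33,2,5],
     [31,1,28,3,29,34,6,7,28,9,34,29,31,34,9,31,1,1,7,29,9,28,7,7,9,6,3,6,28,29,1,31,6,3,34,3],
     [0,28,2,29,4,30,35,7,30,29,10,35,28,28,35,10,30,2,2,4,4,10,29,4,7,10,7,0,28,29,30,2,0,7,0,35],
     [25,34,21,34,21,18,6,12,25,23,12,18,12,31,31,33,25,33,18,31,33,21,34,23,6,25,23,21,23,6,6,31,18,33,34,12],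
     [35,26,35,22,13,22,19,7,19,26,20,13,34,13,28,28,28,26,34,19,20,34,22,35,22,7,26,20,28,20,7,7,13,19,34,35],
     [23,32,27,32,4,14,23,16,14,16,27,21,29,35,14,29,16,29,27,35,32,21,35,23,21,23,4,27,4,29,21,4,32,14,16,35],
     [33,20,33,24,17,5,15,20,22,15,17,24,30,30,32,15,32,17,30,24,20,33,22,32,24,22,20,5,5,5,30,22,32,33,15,17]]"

lemma urd_table_36: "urd_table 36 matchings_36 stars_36"
  by (simp add: urd_table_def matchings_36_def stars_36_def)

lemma exists_URD_36: "exists_K2_K13_URD 36 5 20"
  by (rule exists_URD_table[OF urd_table_36]) (simp_all add: matchings_36_def stars_36_def)

text \<open>Kinds 3 and 5 have their entries 12 in the same places, as both enter a layer of colour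
  0. Kinds 2 to 5 cover the same 72 pairs of points, since kind 8 complements them all.\<close>

definition arc_tables :: "nat list list list" where
  "arc_tables =
   [[[8,8,12,3,3,3,12,6,8,6,6,12],
     [9,12,9,2,2,12,4,2,4,4,12,9],
     [7,1,1,1,12,5,5,12,5,7,12,7],
     [11,11,2,12,11,2,2,7,7,12,7,12],
     [12,9,11,11,4,4,12,4,12,9,9,11],
     [12,0,0,0,12,12,3,3,3,8,8,8],
     [0,10,10,12,0,0,6,12,6,12,10,6],
     [10,12,12,10,1,1,1,5,12,5,5,10]],
    [[11,11,11,12,2,2,12,2,12,6,6,6],
     [10,10,12,1,12,1,1,5,5,12,5,10],
     [7,12,10,10,10,12,4,12,4,4,7,7],
     [9,9,12,11,11,11,3,12,3,3,9,12],
     [6,8,8,0,12,0,0,6,6,12,8,12],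
     [12,0,0,12,0,4,5,4,12,5,4,5],
     [12,7,9,9,3,3,12,3,7,7,12,9],
     [8,12,1,2,1,12,2,1,2,8,12,8]],
    [[1,2,2,1,0,0,12,12,1,0,2,12],
     [7,12,12,6,3,3,12,3,6,6,7,7],
     [2,10,12,12,7,7,7,10,12,2,10,2],
     [9,12,8,9,12,8,11,11,8,12,9,11],
     [12,11,11,8,11,12,3,8,3,8,12,3],
     [4,9,0,12,9,12,4,0,0,9,4,12],
     [12,4,4,5,12,1,5,1,5,4,12,1],
     [5,6,5,10,6,6,10,12,12,12,5,10]],
    [[12,12,12,6,11,7,7,11,6,6,7,11],
     [1,6,2,12,6,6,12,12,1,2,2,1],
     [2,2,12,8,3,8,3,12,3,8,12,2],
     [9,4,4,1,9,1,4,1,12,12,9,12],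
     [5,10,5,12,0,0,5,10,12,0,10,12],
     [12,11,11,5,12,3,11,3,5,12,5,3],
     [4,12,0,10,12,12,10,0,0,4,4,10],
     [7,9,8,9,7,12,12,8,8,9,12,7]],
    [[7,6,12,12,6,7,11,11,12,6,7,11],
     [1,2,2,6,12,6,12,1,6,2,12,1],
     [2,12,8,8,3,3,12,12,3,8,2,2],
     [9,9,4,1,9,1,4,12,1,4,12,12],
     [12,10,5,5,12,0,5,0,0,12,10,10],
     [5,11,11,12,11,12,3,3,5,12,5,3],
     [4,4,0,10,0,12,10,10,12,0,4,12],
     [12,12,12,9,7,8,7,8,8,9,9,7]],
    [[12,12,12,8,3,8,3,8,3,2,2,2],
     [4,10,4,12,6,6,12,12,6,4,10,10],
     [1,6,12,6,7,1,7,12,1,6,12,7],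
     [7,11,11,10,11,7,10,10,12,12,7,12],
     [9,4,0,12,9,0,4,0,12,9,4,12],
     [12,9,5,9,12,3,5,3,5,12,9,3],
     [5,12,8,5,12,12,11,11,8,8,5,11],
     [2,2,2,1,0,12,12,1,0,0,12,1]],
    [[0,2,1,2,0,12,1,12,1,12,0,2],
     [8,10,12,10,12,8,0,0,10,8,12,0],
     [12,11,7,3,7,11,3,12,11,12,3,7],
     [9,12,10,11,12,9,9,10,12,11,11,10],
     [6,12,12,1,3,6,6,3,3,1,12,1],
     [12,6,8,12,6,7,8,6,12,7,7,8],
     [4,5,9,5,9,12,12,5,9,4,4,12],
     [2,4,2,12,5,4,12,2,4,5,5,12]],
    [[5,12,12,9,7,5,9,7,12,9,5,7],
     [2,4,4,12,12,2,10,12,10,10,4,2],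
     [9,7,9,0,12,0,12,0,7,7,9,12],
     [8,1,8,1,4,12,8,1,4,12,12,4],
     [1,10,10,2,2,12,2,12,1,1,10,12],
     [3,0,12,12,3,8,3,8,8,12,0,0],
     [12,5,5,5,6,6,11,6,12,11,12,11],
     [12,12,6,11,11,11,12,3,3,3,6,6]],
    [[12,12,12,1,8,1,2,2,1,8,2,8],
     [12,4,4,3,7,4,7,3,12,7,12,3],
     [6,6,6,12,4,11,11,12,4,11,4,12],
     [10,9,5,9,5,5,10,9,10,12,12,12],
     [11,12,7,12,11,7,12,7,11,5,5,5],
     [3,2,3,2,3,9,12,12,12,2,9,9],
     [0,10,8,10,12,12,0,8,0,12,8,10],
     [1,1,12,0,12,12,6,1,6,6,0,0]]]"

interpretation arc_tables: arc_system "\<lambda>i k a. arc_tables ! i ! k ! a"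
proof
  show "arc_compatible (\<lambda>i k a. arc_tables ! i ! k ! a) i j"
    if "(i, j) \<in> {(0,1), (1,0), (4,5), (5,2), (2,3), (3,2), (2,4), (8,6), (6,7), (7,8)}" for i j
    using that unfolding insert_iff empty_iff prod.inject
    by (intro arc_compatible_tables; elim disjE conjE FalseE)
      (simp_all add: arc_tables_def compatible_tables_def)
  show "arc_complementary (\<lambda>i k a. arc_tables ! i ! k ! a) i j"
    if "(i, j) \<in> {(0,1), (6,7), (8,2), (8,3), (8,4), (8,5)}" for i j
    using that unfolding insert_iff empty_iff prod.inject
    by (intro arc_complementary_tables; elim disjE conjE FalseE)
      (simp_all add: arc_tables_def complementary_tables_def)
qed

text \<open>\<open>N = 0\<close> is the hole alone and \<open>N = 1\<close> the local design;
  \<open>N = 2\<close> admits no frame and relies on a separate table.\<close>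

lemma exists_URD_all:
  assumes "subsystem w r s f" and "0 < w"
    and "exists_K2_K13_URD (12 + w) r (8 + s)" and "exists_K2_K13_URD (24 + w) r (16 + s)"
  shows "exists_K2_K13_URD (12 * N + w) r (8 * N + s)"
proof -
  consider "N = 0" | "N = 1" | "N = 2" | "3 \<le> N" by linarith
  then show ?thesis
  proof cases
    case 1 then show ?thesis using subsystem_restrict[OF assms(1,2)] by simp
  next
    case 4 then show ?thesis by (rule arc_tables.exists_URD_subsystem[OF assms(1)])
  qed (use assms(3,4) in simp_all)
qed

theorem mainTheorem1:
  fixes v :: nat
  assumes "v > 0"
    and "v mod 4 = 0"
    and "v \<notin> {40, 44, 52, 76, 92, 100, 280, 284, 328, 332, 428, 472, 476, 572}"
  shows "exists_K2_K13_URD v (r_of v) (s_of v)"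
proof -
  \<comment> \<open>Multiples of 12 keep 12 points at infinity: without any, the eight star classes
    on a layer would need 72 edges, but 12 points span only 66.\<close>
  have "\<exists>N. v = 12 * N + 4 \<or> v = 12 * N + 8 \<or> v = 12 * N + 12"
    using assms(1,2) by presburger
  then obtain N where "v = 12 * N + 4 \<or> v = 12 * N + 8 \<or> v = 12 * N + 12" ..
  then show ?thesis
  proof (elim disjE)
    assume v: "v = 12 * N + 4"
    have "r_of v = 3" "s_of v = 8 * N + 0" by (simp_all add: v r_of_def s_of_def)
    then show ?thesis
      using exists_URD_all[OF subsystem_16, of N] exists_URD_16 exists_URD_28 by (simp add: v)
  next
    assume v: "v = 12 * N + 8"
    have "r_of v = 1" "s_of v = 8 * N + 4" by (simp_all add: v r_of_def s_of_def)
    then show ?thesis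
      using exists_URD_all[OF subsystem_20, of N] exists_URD_20 exists_URD_32 by (simp add: v)
  next
    assume v: "v = 12 * N + 12"
    have "r_of v = 5" "s_of v = 8 * N + 4" by (simp_all add: v r_of_def s_of_def)
    then show ?thesis
      using exists_URD_all[OF subsystem_24, of N] exists_URD_24 exists_URD_36 by (simp add: v)
  qed
qed

end
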